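(* Let $\mathtt r\le \mathtt r_0$ and suppose that the following two conditions hold for this $\mathtt r$. (i) There is a constant $\omega(\mathtt r)\in[0,1/2]$ such that for all $\theta\in\Theta_0(\mathtt r)$ and all $|\lambda|\le \mathtt g$, $$\sup_{\gamma\in\mathbb R^p\setminus\{0\}}\log \mathbb E\exp\Big\{\lambda\,\frac{\gamma^\top\{\nabla\zeta(\theta)-\nabla\zeta(\theta^* )\}}{\omega(\mathtt r)\,\|V_0\gamma\|}\Big\}\le \frac{\nu_0^2\lambda^2}{2}.$$ (ii) There are a symmetric strictly positive-definite matrix $D_0^2$ and a constant $\delta(\mathtt r)\in[0,1/2]$ such that for all $\theta\in\Theta_0(\mathtt r)$, $\theta\neq\theta^*$, $$\Big|\frac{-2\,\mathbb E L(\theta,\theta^* )}{\|D_0(\theta-\theta^* )\|^2}-1\Big|\le\delta(\mathtt r).$$ Let the values $\varrho\ge 3\nu_0\,\omega(\mathtt r)$ and $\delta\ge\delta(\mathtt r)$ be such that $D_0^2(1-\delta)-\varrho V_0^2\ge 0$. Set $\epsilon=(\delta,\varrho)$ and $\underline\epsilon=-\epsilon$. Then $$\mathbb L_{\underline\epsilon}(\theta,\theta^* )-\Diamond_{\underline\epsilon}(\mathtt r)\;\le\; L(\theta,\theta^* )\;\le\;\mathbb L_{\epsilon}(\theta,\theta^* )+\Diamond_{\epsilon}(\mathtt r)\qquad\text{for all }\theta\in\Theta_0(\mathtt r).$$ Moreover, if $\mathtt g_0:=\mathtt g\,\nu_0\ge 3$, then for every $\mathtt x>0$ the error terms satisfy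 $$\mathbb P\{\varrho^{-1}\Diamond_{\epsilon}(\mathtt r)\ge \mathfrak z_0(\mathtt x,\mathbb Q)\}\le e^{-\mathtt x},\qquad \mathbb P\{\varrho^{-1}\Diamond_{\underline\epsilon}(\mathtt r)\ge \mathfrak z_0(\mathtt x,\mathbb Q)\}\le e^{-\mathtt x}.$$
   Context: Setting. $\Theta\subseteq\mathbb R^p$. The data $Y$ have a distribution $\mathbb P$ with expectation $\mathbb E$. $L(\theta)=L(Y,\theta)$, $\theta\in\Theta$, is a random function (a quasi log-likelihood; $\mathbb P$ need not belong to any parametric family). Put $L(\theta,\theta')=L(\theta)-L(\theta')$. The target is $\theta^*=\arg\max_{\theta\in\Theta}\mathbb E L(\theta)$, and $\nabla\mathbb E L(\theta^* )=0$. The stochastic component $\zeta(\theta)=L(\theta)-\mathbb E L(\theta)$ is differentiable in $\theta$; thus $\nabla L(\theta^* )=\nabla\zeta(\theta^* )$. $V_0^2$ is a symmetric positive-definite $p\times p$ matrix (with symmetric root $V_0$), and $\mathtt g>0$, $\nu_0\ge1$, $\mathtt r_0>0$ are constants. The local set is $\Theta_0(\mathtt r)=\{\theta\in\Theta:\|V_0(\theta-\theta^* )\|\le \mathtt r\}$. When $\omega(\mathtt r)=0$, condition (i) means $\nabla\zeta(\theta)=\nabla\zeta(\theta^* )$ on $\Theta_0(\mathtt r)$. For $\epsilon=(\delta,\varrho)$ with $\delta,\varrho\ge0$ and $\underline\epsilon=-\epsilon$ put $D_\epsilon^2=D_0^2(1-\delta)-\varrho V_0^2$, $D_{\underline\epsilon}^2=D_0^2(1+\delta)+\varrho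 V_0^2$, and $$\mathbb L_{\epsilon}(\theta,\theta^* )=(\theta-\theta^* )^\top\nabla L(\theta^* )-\tfrac12\|D_{\epsilon}(\theta-\theta^* )\|^2,$$ $$\mathbb L_{\underline\epsilon}(\theta,\theta^* )=(\theta-\theta^* )^\top\nabla L(\theta^* )-\tfrac12\|D_{\underline\epsilon}(\theta-\theta^* )\|^2 .$$ The error terms are, with $\zeta(\theta,\theta^* )=\zeta(\theta)-\zeta(\theta^* )$, $$\Diamond_{\epsilon}(\mathtt r)=\sup_{\theta\in\Theta_0(\mathtt r)}\Big\{\zeta(\theta,\theta^* )-(\theta-\theta^* )^\top\nabla\zeta(\theta^* )-\tfrac{\varrho}{2}\|V_0(\theta-\theta^* )\|^2\Big\},$$ $$\Diamond_{\underline\epsilon}(\mathtt r)=\sup_{\theta\in\Theta_0(\mathtt r)}\Big\{-\zeta(\theta,\theta^* )+(\theta-\theta^* )^\top\nabla\zeta(\theta^* )-\tfrac{\varrho}{2}\|V_0(\theta-\theta^* )\|^2\Big\}.$$ The probability bounds, which involve $\varrho^{-1}$, are read for $\varrho>0$; the bracketing inequality includes the case $\varrho=0$. With $\mathtt g_0=\mathtt g\nu_0$ and $\mathbb Q=\mathfrak c_1p$, where $\mathfrak c_1=2$ for $p\ge2$ and $\mathfrak c_1=2.7$ for $p=1$, $$\mathfrak z_0(\mathtt x,\mathbb Q)=\begin{cases}(1+\sqrt{\mathtt x+\mathbb Q})^2,&1+\sqrt{\mathtt x+\mathbb Q}\le\mathtt g_0,\\ 1+\{2\mathtt g_0^{-1}(\mathtt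 x+\mathbb Q)+\mathtt g_0\}^2,&\text{otherwise.}\end{cases}$$
   Formalization: The probability bounds are proved under the added assumption that the local set Θ_0(r) is convex; without it they fail, e.g. for Θ=ℝ∖[1,2] with ζ equal to 0 left of 1 and to a large random constant right of 2. The bracketing inequality needs no such assumption. *)

theory Defs
  imports "HOL-Probability.Probability"
begin

(* Only meaningful where f is differentiable; the derivative is the full one, "at x". *)
definition grad :: "('a::real_inner \<Rightarrow> real) \<Rightarrow> 'a \<Rightarrow> 'a" where
  "grad f x = (THE D. GDERIV f x :> D)"

definition sym_psd :: "real^'p^'p \<Rightarrow> bool" where
  "sym_psd A \<longleftrightarrow> transpose A = A \<and> (\<forall>x. 0 \<le> x \<bullet> (A *v x))"

definition sym_pd :: "real^'p^'p \<Rightarrow> bool" where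
  "sym_pd A \<longleftrightarrow> transpose A = A \<and> (\<forall>x. x \<noteq> 0 \<longrightarrow> 0 < x \<bullet> (A *v x))"

(* The squared matrices V0^2, D0^2 and D_eps^2 are the primitive objects (V0sq, D0sq, Dsq below);
   V0, D0 and D_eps are their symmetric positive semidefinite square roots. *)
definition sym_root :: "real^'p^'p \<Rightarrow> real^'p^'p" where
  "sym_root A = (SOME B. sym_psd B \<and> B ** B = A)"

(* In what follows P is the distribution of the data and y a data value. *)
definition mean_L :: "'y measure \<Rightarrow> ('y \<Rightarrow> real^'p \<Rightarrow> real) \<Rightarrow> real^'p \<Rightarrow> real" where
  "mean_L P L \<theta> = (\<integral>y. L y \<theta> \<partial>P)"

definition stoch :: "'y measure \<Rightarrow> ('y \<Rightarrow> real^'p \<Rightarrow> real) \<Rightarrow> 'y \<Rightarrow> real^'p \<Rightarrow> real" where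
  "stoch P L y \<theta> = L y \<theta> - mean_L P L \<theta>"

definition local_set :: "(real^'p) set \<Rightarrow> real^'p^'p \<Rightarrow> real^'p \<Rightarrow> real \<Rightarrow> (real^'p) set" where
  "local_set \<Theta> V0sq \<theta>s r = {\<theta>\<in>\<Theta>. norm (sym_root V0sq *v (\<theta> - \<theta>s)) \<le> r}"

(* log E exp X, which is infinite when exp X has no finite expectation
   (the Bochner integral alone would give 0). *)
definition log_exp_moment :: "'y measure \<Rightarrow> ('y \<Rightarrow> real) \<Rightarrow> ereal" where
  "log_exp_moment P X =
     (if integrable P (\<lambda>y. exp (X y)) then ereal (ln (\<integral>y. exp (X y) \<partial>P)) else \<infinity>)"

(* For \<omega> = 0 the quotient is not defined (in HOL it would be 0 and the condition void); the condition
   then says that the gradient increment vanishes, almost surely at each point of the set. *)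
definition gradient_moment_cond ::
  "'y measure \<Rightarrow> ('y \<Rightarrow> real^'p \<Rightarrow> real) \<Rightarrow> (real^'p) set \<Rightarrow> real^'p \<Rightarrow> real^'p^'p
    \<Rightarrow> real \<Rightarrow> real \<Rightarrow> real \<Rightarrow> bool" where
  "gradient_moment_cond P \<zeta> S \<theta>s V0sq g \<nu>0 \<omega> \<longleftrightarrow>
     (if \<omega> = 0 then \<forall>\<theta>\<in>S. AE y in P. grad (\<zeta> y) \<theta> = grad (\<zeta> y) \<theta>s
      else \<forall>\<theta>\<in>S. \<forall>t. \<bar>t\<bar> \<le> g \<longrightarrow>
        (SUP \<gamma>\<in>UNIV - {0}. log_exp_moment P (\<lambda>y.
            t * ((\<gamma> \<bullet> (grad (\<zeta> y) \<theta> - grad (\<zeta> y) \<theta>s)) / (\<omega> * norm (sym_root V0sq *v \<gamma>)))))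
          \<le> ereal (\<nu>0\<^sup>2 * t\<^sup>2 / 2))"

(* D_eps^2 for eps = (\<delta>, \<rho>); minus eps is the argument pair (-\<delta>, -\<rho>). *)
definition D_eps_sq :: "real^'p^'p \<Rightarrow> real^'p^'p \<Rightarrow> real \<Rightarrow> real \<Rightarrow> real^'p^'p" where
  "D_eps_sq D0sq V0sq \<delta> \<rho> = (1 - \<delta>) *\<^sub>R D0sq - \<rho> *\<^sub>R V0sq"

definition quad_L :: "('y \<Rightarrow> real^'p \<Rightarrow> real) \<Rightarrow> real^'p^'p \<Rightarrow> 'y \<Rightarrow> real^'p \<Rightarrow> real^'p \<Rightarrow> real" where
  "quad_L L Dsq y \<theta> \<theta>s =
     (\<theta> - \<theta>s) \<bullet> grad (L y) \<theta>s - 1/2 * (norm (sym_root Dsq *v (\<theta> - \<theta>s)))\<^sup>2"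

(* The error terms are suprema of possibly unbounded functions, hence extended reals. *)
definition err_upper ::
  "('y \<Rightarrow> real^'p \<Rightarrow> real) \<Rightarrow> (real^'p) set \<Rightarrow> real^'p \<Rightarrow> real^'p^'p \<Rightarrow> real \<Rightarrow> 'y \<Rightarrow> ereal" where
  "err_upper \<zeta> S \<theta>s V0sq \<rho> y =
     (SUP \<theta>\<in>S. ereal ((\<zeta> y \<theta> - \<zeta> y \<theta>s) - (\<theta> - \<theta>s) \<bullet> grad (\<zeta> y) \<theta>s
        - \<rho> / 2 * (norm (sym_root V0sq *v (\<theta> - \<theta>s)))\<^sup>2))"

definition err_lower ::
  "('y \<Rightarrow> real^'p \<Rightarrow> real) \<Rightarrow> (real^'p) set \<Rightarrow> real^'p \<Rightarrow> real^'p^'p \<Rightarrow> real \<Rightarrow> 'y \<Rightarrow> ereal" where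
  "err_lower \<zeta> S \<theta>s V0sq \<rho> y =
     (SUP \<theta>\<in>S. ereal (- (\<zeta> y \<theta> - \<zeta> y \<theta>s) + (\<theta> - \<theta>s) \<bullet> grad (\<zeta> y) \<theta>s
        - \<rho> / 2 * (norm (sym_root V0sq *v (\<theta> - \<theta>s)))\<^sup>2))"

definition entropy_Q :: "nat \<Rightarrow> real" where
  "entropy_Q p = (if p \<ge> 2 then 2 else 2.7) * real p"

definition z0 :: "real \<Rightarrow> real \<Rightarrow> real \<Rightarrow> real" where
  "z0 g0 x Q =
     (if 1 + sqrt (x + Q) \<le> g0 then (1 + sqrt (x + Q))\<^sup>2
      else 1 + (2 * inverse g0 * (x + Q) + g0)\<^sup>2)"

end

theory Submission
  imports Defs
begin

text \<open>
  The two parts of the result are independent. The bracketing is deterministic: in the splitting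
  of L into its mean and its stochastic component, the condition on the mean replaces the mean
  increment by a quadratic form up to the factors 1 - \<delta> and 1 + \<delta>, and what is left is
  the linearisation remainder W of the stochastic component at the target point. Adding and
  subtracting the penalty with factor \<rho> / 2 turns this remainder into a term of the supremum
  that defines the error term (quad_form_bracketing).

  For the tail bounds, measure distances between parameters in the norm of V0. The gradient of W is
  the increment of the gradient of the stochastic component. Writing an increment of W as the
  integral of the directional derivative along a segment, which stays in the local set because
  this set is convex, and applying Jensen's inequality, one sees that the increments of W / \<rho>
  have the exponential moments of a centred Gaussian process with standard deviation 1/3 times the
  distance, for exponents up to 3 g0, where g0 is g times \<nu>0; the factor 3 is the one in
  \<rho> \<ge> 3 \<nu>0 \<omega> (subexp_increments_lin_remainder).

  Chaining over dyadic nets then controls the supremum over a finite set of points in a ball of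
  radius R. The net at level m has at most 2 to the power (m + 3) p points by comparison of
  volumes, the chains have total length below 2 R, and so the supremum divided by R has an
  exponential moment with exponent 4 p ln 2 + 2 \<mu>^2 / 9 (chaining_bound). A chain of length 2 R
  with standard deviation 1/3 per unit of length has standard deviation 2/3 per unit of R instead
  of 1, and this gain pays for all the losses below.

  The quadratic penalty is treated by slicing the parameter set into shells whose radii form a
  geometric progression with ratio q. On a shell of outer radius R the penalised process can reach
  the level z only if the supremum divided by R reaches z / R + R / (2 q^2). The minimum of this
  expression over R is sqrt (2 z) / q, and it grows at least linearly with the number of shells between
  R and the minimiser, so that the union bound is a geometric series (penalized_tail_finite). With
  q = 11/10 and an exponent \<mu> adapted to the two branches of the quantile function z0, this
  series is at most exp (- x), even for 99/100 of the level z0 (penalized_tail_numeric). The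
  spare hundredth allows the passage from finite sets to a countable dense set and, by continuity
  of the paths, to a supremum that need not be attained (penalized_remainder_sup).
\<close>

section \<open>Symmetric square roots of matrices\<close>

lemma quadratic_nonneg_imp_linear_zero:
  fixes b c :: real
  assumes "\<And>t. 0 \<le> 2 * t * b + t\<^sup>2 * c"
  shows "b = 0"
proof (rule ccontr)
  assume b: "b \<noteq> 0"
  define k where "k = \<bar>c\<bar> + 1"
  have k: "k > 0" "c < k" by (auto simp: k_def)
  have "0 \<le> 2 * (- b / k) * b + (- b / k)\<^sup>2 * c" by (rule assms)
  also have "\<dots> = (b\<^sup>2 / k) * (c / k - 2)"
    using k by (simp add: field_simps power2_eq_square)
  also have "\<dots> < 0"
    using b k by (intro mult_pos_neg) (auto simp: field_simps)
  finally show False by simp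
qed

text \<open>
  The spectral theorem, by induction on the dimension of an invariant subspace. A maximiser of the
  quadratic form on the unit sphere of the subspace is an eigenvector: the nonnegative form that
  measures the distance to the maximum vanishes there, and so does its first variation. The
  orthogonal complement of the eigenvector is again invariant.
\<close>

lemma symmetric_psd_eigen_expansion:
  fixes f :: "'a::euclidean_space \<Rightarrow> 'a"
  assumes lin: "linear f" and sym: "\<And>x y. f x \<bullet> y = x \<bullet> f y" and psd: "\<And>x. 0 \<le> x \<bullet> f x"
  shows "subspace S \<Longrightarrow> f ` S \<subseteq> S \<Longrightarrow>
    \<exists>B c. finite B \<and> B \<subseteq> S \<and> (\<forall>v\<in>B. norm v = 1) \<and> pairwise orthogonal B \<and>
          (\<forall>v\<in>B. 0 \<le> c v) \<and> (\<forall>x\<in>S. f x = (\<Sum>v\<in>B. (c v * (x \<bullet> v)) *\<^sub>R v))"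
proof (induction "dim S" arbitrary: S rule: less_induct)
  case less
  show ?case
  proof (cases "S \<subseteq> {0}")
    case True
    then show ?thesis
      using linear_0[OF lin] by (intro exI[of _ "{}"]) auto
  next
    case False
    then obtain s where s: "s \<in> S" "s \<noteq> 0" by auto
    have "compact (S \<inter> sphere 0 1)"
      by (intro closed_Int_compact closed_subspace less.prems compact_sphere)
    moreover have "(1 / norm s) *\<^sub>R s \<in> S \<inter> sphere 0 1"
      using s less.prems by (auto intro: subspace_scale)
    moreover have "continuous_on (S \<inter> sphere 0 1) (\<lambda>x. x \<bullet> f x)"
      using lin by (intro continuous_intros linear_continuous_on)
        (simp add: linear_conv_bounded_linear)
    ultimately obtain v where v: "v \<in> S" "norm v = 1"
      and vmax: "\<And>x. x \<in> S \<Longrightarrow> norm x = 1 \<Longrightarrow> x \<bullet> f x \<le> v \<bullet> f v"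
      using continuous_attains_sup[of "S \<inter> sphere 0 1" "\<lambda>x. x \<bullet> f x"] by force
    define l where "l = v \<bullet> f v"
    have quad: "x \<bullet> f x \<le> l * (x \<bullet> x)" if "x \<in> S" for x
    proof (cases "x = 0")
      case False
      have "((1 / norm x) *\<^sub>R x) \<bullet> f ((1 / norm x) *\<^sub>R x) \<le> l"
        unfolding l_def using that less.prems False by (intro vmax subspace_scale) auto
      moreover have "((1 / norm x) *\<^sub>R x) \<bullet> f ((1 / norm x) *\<^sub>R x) = (x \<bullet> f x) / (norm x)\<^sup>2"
        using lin by (simp add: linear_cmul power2_eq_square)
      ultimately have "(x \<bullet> f x) / (norm x)\<^sup>2 \<le> l" by simp
      then show ?thesis
        using False by (simp add: divide_le_eq power2_norm_eq_inner)
    qed (simp add: linear_0[OF lin])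
    have eig: "f v = l *\<^sub>R v"
    proof -
      define w where "w = f v - l *\<^sub>R v"
      have w: "w \<in> S"
        unfolding w_def using v less.prems by (intro subspace_diff subspace_scale) auto
      have "0 \<le> 2 * t * (l * (v \<bullet> w) - w \<bullet> f v) + t\<^sup>2 * (l * (w \<bullet> w) - w \<bullet> f w)" for t
      proof -
        have "v + t *\<^sub>R w \<in> S"
          using v w less.prems by (intro subspace_add subspace_scale)
        from quad[OF this] have "(v + t *\<^sub>R w) \<bullet> (f v + t *\<^sub>R f w) \<le> l * ((v + t *\<^sub>R w) \<bullet> (v + t *\<^sub>R w))"
          using lin by (simp add: linear_add linear_cmul)
        moreover have "v \<bullet> f w = w \<bullet> f v" by (metis sym inner_commute)
        moreover have "v \<bullet> v = 1" using v by (simp add: norm_eq_1)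
        moreover have "v \<bullet> f v = l" by (simp add: l_def)
        ultimately show ?thesis
          by (simp add: algebra_simps inner_add_left inner_add_right power2_eq_square inner_commute)
      qed
      then have "l * (v \<bullet> w) - w \<bullet> f v = 0"
        by (rule quadratic_nonneg_imp_linear_zero)
      then have "w \<bullet> w = 0"
        by (simp add: w_def inner_diff_left inner_diff_right inner_commute algebra_simps)
      then show ?thesis by (simp add: w_def)
    qed
    define S' where "S' = S \<inter> {x. v \<bullet> x = 0}"
    have sub': "subspace S'"
      unfolding S'_def by (intro subspace_inter less.prems subspace_hyperplane)
    have "v \<notin> S'" using v by (auto simp: S'_def)
    then have "S' \<subset> S" using v unfolding S'_def by blast
    then have "dim S' < dim S"
      using sub' less.prems(1) by (intro dim_psubset) (simp add: span_eq_iff[THEN iffD2])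
    moreover have "f ` S' \<subseteq> S'"
      using less.prems(2) eig by (auto simp: S'_def sym[symmetric])
    ultimately obtain B c where B: "finite B" "B \<subseteq> S'" "\<forall>b\<in>B. norm b = 1" "pairwise orthogonal B"
      and c: "\<forall>b\<in>B. 0 \<le> c b" and fx: "\<forall>x\<in>S'. f x = (\<Sum>b\<in>B. (c b * (x \<bullet> b)) *\<^sub>R b)"
      using less.hyps[OF _ sub'] by blast
    have vB: "v \<notin> B" using B \<open>v \<notin> S'\<close> by auto
    have orth: "v \<bullet> b = 0" if "b \<in> B" for b using that B by (auto simp: S'_def)
    define c' where "c' = c(v := l)"
    have "f x = (\<Sum>b\<in>insert v B. (c' b * (x \<bullet> b)) *\<^sub>R b)" if x: "x \<in> S" for x
    proof -
      define z where "z = x - (x \<bullet> v) *\<^sub>R v"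
      have z: "z \<in> S'"
        using x v less.prems
        by (auto simp: S'_def z_def inner_diff_right inner_commute norm_eq_1 intro: subspace_diff subspace_scale)
      have "f x = f ((x \<bullet> v) *\<^sub>R v + z)" by (simp add: z_def)
      also have "\<dots> = (l * (x \<bullet> v)) *\<^sub>R v + f z"
        by (simp add: linear_add[OF lin] linear_cmul[OF lin] eig)
      also have "f z = (\<Sum>b\<in>B. (c b * (z \<bullet> b)) *\<^sub>R b)" using fx z by blast
      also have "\<dots> = (\<Sum>b\<in>B. (c' b * (x \<bullet> b)) *\<^sub>R b)"
        using vB orth by (intro sum.cong) (auto simp: c'_def z_def inner_diff_left)
      finally show ?thesis
        using B vB by (simp add: c'_def)
    qed
    moreover have "\<forall>b\<in>insert v B. 0 \<le> c' b"
      using c psd by (auto simp: c'_def l_def)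
    moreover have "pairwise orthogonal (insert v B)"
      using B orth by (auto simp: pairwise_insert orthogonal_def inner_commute)
    moreover have "insert v B \<subseteq> S" using B v by (auto simp: S'_def)
    ultimately show ?thesis
      using B v by (intro exI[of _ "insert v B"] exI[of _ c']) auto
  qed
qed

lemma sym_matrix_inner:
  fixes A :: "real^'p^'p"
  assumes "transpose A = A"
  shows "(A *v x) \<bullet> y = x \<bullet> (A *v y)"
  using assms by (metis dot_lmul_matrix transpose_matrix_vector)

text \<open>
  Taking square roots of the eigenvalues gives a root, so that the choice in the definition of
  the symmetric root is from a nonempty set.
\<close>

lemma sym_root_spec:
  fixes A :: "real^'p^'p"
  assumes "sym_psd A"
  shows "sym_psd (sym_root A)" "sym_root A ** sym_root A = A"
proof -
  have A: "transpose A = A" "\<And>x. 0 \<le> x \<bullet> (A *v x)"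
    using assms by (auto simp: sym_psd_def)
  from symmetric_psd_eigen_expansion[of "(*v) A" UNIV]
  obtain B c where B: "finite B" "\<forall>v\<in>B. norm v = 1" "pairwise orthogonal B" "\<forall>v\<in>B. 0 \<le> c v"
    and Ax: "\<And>x. A *v x = (\<Sum>v\<in>B. (c v * (x \<bullet> v)) *\<^sub>R v)"
    using sym_matrix_inner[OF A(1)] A(2) by auto
  define f where "f x = (\<Sum>v\<in>B. (sqrt (c v) * (x \<bullet> v)) *\<^sub>R v)" for x
  have lin: "linear f"
    unfolding f_def
    by (intro linearI) (simp_all add: algebra_simps sum.distrib scaleR_sum_right inner_add_left)
  define R where "R = matrix f"
  have R: "R *v x = f x" for x
    unfolding R_def by (simp add: lin matrix_works)
  have fxy: "f x \<bullet> y = (\<Sum>v\<in>B. sqrt (c v) * (x \<bullet> v) * (y \<bullet> v))" for x y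
    unfolding f_def inner_sum_left inner_scaleR_left by (simp only: inner_commute[of _ y])
  have symR: "(R *v x) \<bullet> y = x \<bullet> (R *v y)" for x y
    unfolding R by (subst (2) inner_commute) (simp add: fxy mult_ac)
  have "transpose R = R"
  proof -
    have "(transpose R *v x) \<bullet> y = (R *v x) \<bullet> y" for x y
      by (metis symR dot_lmul_matrix transpose_matrix_vector)
    then have "transpose R *v x = R *v x" for x
      using vector_eq_rdot by blast
    then show ?thesis by (simp add: matrix_eq)
  qed
  moreover have "0 \<le> x \<bullet> (R *v x)" for x
  proof -
    have "0 \<le> f x \<bullet> x"
      unfolding fxy using B(4) by (intro sum_nonneg) (simp add: mult.assoc)
    then show ?thesis by (simp add: R inner_commute)
  qed
  ultimately have "sym_psd R" by (simp add: sym_psd_def)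
  moreover have "R ** R = A"
  proof -
    have fv: "f x \<bullet> v = sqrt (c v) * (x \<bullet> v)" if "v \<in> B" for x v
    proof -
      have "f x \<bullet> v = (\<Sum>w\<in>B. if w = v then sqrt (c v) * (x \<bullet> v) else 0)"
        unfolding fxy using B(2,3) that
        by (intro sum.cong) (auto simp: pairwise_def orthogonal_def norm_eq_1)
      then show ?thesis using B(1) that by simp
    qed
    have "f (f x) = A *v x" for x
      unfolding Ax f_def[of "f x"] using B(4) by (intro sum.cong) (auto simp: fv)
    then have "(R ** R) *v x = A *v x" for x
      by (simp add: matrix_vector_mul_assoc[symmetric] R)
    then show ?thesis by (simp add: matrix_eq)
  qed
  ultimately have "\<exists>B. sym_psd B \<and> B ** B = A" by blast
  from someI_ex[OF this] show "sym_psd (sym_root A)" "sym_root A ** sym_root A = A"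
    unfolding sym_root_def by auto
qed

lemma norm_sym_root_sq:
  fixes A :: "real^'p^'p"
  assumes "sym_psd A"
  shows "(norm (sym_root A *v x))\<^sup>2 = x \<bullet> (A *v x)"
proof -
  have "(norm (sym_root A *v x))\<^sup>2 = x \<bullet> (sym_root A *v (sym_root A *v x))"
    using sym_root_spec(1)[OF assms]
    by (simp add: power2_norm_eq_inner sym_psd_def sym_matrix_inner)
  then show ?thesis
    by (simp add: matrix_vector_mul_assoc sym_root_spec(2)[OF assms])
qed

lemma sym_pd_imp_psd: "sym_pd A \<Longrightarrow> sym_psd A"
  unfolding sym_pd_def sym_psd_def by (metis inner_zero_left less_eq_real_def)

section \<open>Exponential moments of increments from those of the derivative\<close>

text \<open>
  The function is the pointwise limit of the functions obtained by rounding the second argument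
  down to a multiple of 1 / (n + 1), each of which involves only countably many sections.
\<close>

lemma borel_measurable_caratheodory:
  fixes f :: "'y \<Rightarrow> real \<Rightarrow> real"
  assumes meas: "\<And>t. (\<lambda>y. f y t) \<in> borel_measurable M"
    and cont: "\<And>y. y \<in> space M \<Longrightarrow> continuous_on UNIV (f y)"
  shows "(\<lambda>(y, t). f y t) \<in> borel_measurable (M \<Otimes>\<^sub>M borel)"
proof -
  define q where "q n t = real_of_int \<lfloor>t * real (Suc n)\<rfloor> / real (Suc n)" for n t
  have lim: "(\<lambda>n. q n t) \<longlonglongrightarrow> t" for t
  proof (rule tendsto_sandwich)
    show "\<forall>\<^sub>F n in sequentially. t - 1 / real (Suc n) \<le> q n t"
    proof (intro always_eventually allI)
      fix n
      have "(t * real (Suc n) - 1) / real (Suc n) \<le> q n t"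
        unfolding q_def by (intro divide_right_mono) linarith+
      then show "t - 1 / real (Suc n) \<le> q n t"
        by (simp add: diff_divide_distrib del: of_nat_Suc)
    qed
    show "\<forall>\<^sub>F n in sequentially. q n t \<le> t"
      unfolding q_def by (intro always_eventually allI) (simp add: divide_le_eq del: of_nat_Suc)
    show "(\<lambda>n. t - 1 / real (Suc n)) \<longlonglongrightarrow> t"
      using tendsto_diff[OF tendsto_const lim_1_over_n[THEN LIMSEQ_Suc], of t] by simp
  qed simp
  show ?thesis
  proof (rule borel_measurable_LIMSEQ_real)
    fix n
    have "(\<lambda>z. (\<lambda>i z. f (fst z) (real_of_int i / real (Suc n))) \<lfloor>snd z * real (Suc n)\<rfloor> z)
        \<in> borel_measurable (M \<Otimes>\<^sub>M borel)"
      by (rule measurable_compose_countable) (auto intro: measurable_compose[OF measurable_fst meas])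
    then show "(\<lambda>z. f (fst z) (q n (snd z))) \<in> borel_measurable (M \<Otimes>\<^sub>M borel)"
      by (simp add: q_def)
  next
    fix z assume "z \<in> space (M \<Otimes>\<^sub>M (borel :: real measure))"
    then have "isCont (f (fst z)) (snd z)"
      using cont[of "fst z"] by (auto simp: space_pair_measure continuous_on_eq_continuous_at)
    then show "(\<lambda>n. f (fst z) (q n (snd z))) \<longlonglongrightarrow> (case z of (y, t) \<Rightarrow> f y t)"
      using isCont_tendsto_compose[OF _ lim] by (simp add: case_prod_beta)
  qed
qed

lemma exp_ge_tangent: "exp m * (1 + (x - m)) \<le> exp (x :: real)"
proof -
  have "exp m * (1 + (x - m)) \<le> exp m * exp (x - m)"
    by (intro mult_left_mono exp_ge_add_one_self) auto
  then show ?thesis by (simp add: mult_exp_exp)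
qed

text \<open>
  An everywhere differentiable function need not have a Lebesgue integrable derivative, but the
  gauge integral of the derivative always recovers the increment. The two finite exponential
  integrals bound the absolute value of the derivative, so that both integrals exist and agree, and
  Jensen's inequality for the uniform distribution on the unit interval follows from the tangent
  to the exponential at the mean m.
\<close>

lemma jensen_exp_derivative:
  fixes f d :: "real \<Rightarrow> real"
  assumes der: "\<And>t. t \<in> {0..1} \<Longrightarrow> (f has_real_derivative d t) (at t within {0..1})"
    and meas: "set_borel_measurable lborel {0..1} d"
    and fin: "(\<integral>\<^sup>+t\<in>{0..1}. ennreal (exp (d t)) \<partial>lborel) < \<infinity>"
      "(\<integral>\<^sup>+t\<in>{0..1}. ennreal (exp (- d t)) \<partial>lborel) < \<infinity>"
  shows "ennreal (exp (f 1 - f 0)) \<le> (\<integral>\<^sup>+t\<in>{0..1}. ennreal (exp (d t)) \<partial>lborel)"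
proof -
  let ?I = "indicator {0..1::real} :: real \<Rightarrow> real"
  have m[measurable]: "(\<lambda>t. ?I t * d t) \<in> borel_measurable lborel"
    using meas by (simp add: set_borel_measurable_def)
  have e1: "?I t * exp (d t) = ?I t * exp (?I t * d t)"
    and e2: "?I t * exp (- d t) = ?I t * exp (- (?I t * d t))" for t
    by (auto simp: indicator_def)
  have int1: "integrable lborel (\<lambda>t. ?I t * exp (d t))"
  proof (rule integrableI_nonneg)
    show "(\<lambda>t. ?I t * exp (d t)) \<in> borel_measurable lborel"
      unfolding e1 by measurable
    show "(\<integral>\<^sup>+t. ennreal (?I t * exp (d t)) \<partial>lborel) < \<infinity>"
      using fin(1) by (simp add: ennreal_mult' mult.commute ennreal_indicator)
  qed auto
  have int2: "integrable lborel (\<lambda>t. ?I t * exp (- d t))"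
  proof (rule integrableI_nonneg)
    show "(\<lambda>t. ?I t * exp (- d t)) \<in> borel_measurable lborel"
      unfolding e2 by measurable
    show "(\<integral>\<^sup>+t. ennreal (?I t * exp (- d t)) \<partial>lborel) < \<infinity>"
      using fin(2) by (simp add: ennreal_mult' mult.commute ennreal_indicator)
  qed auto
  have int: "integrable lborel (\<lambda>t. ?I t * d t)"
  proof (rule Bochner_Integration.integrable_bound[OF Bochner_Integration.integrable_add[OF int1 int2]])
    have "\<bar>x\<bar> \<le> exp x + exp (- x)" for x :: real
      using exp_ge_add_one_self[of x] exp_ge_add_one_self[of "-x"] exp_ge_zero[of x] exp_ge_zero[of "-x"]
      by linarith
    from this[of "d _"] show "AE t in lborel. norm (?I t * d t) \<le> norm (?I t * exp (d t) + ?I t * exp (- d t))"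
      by (intro always_eventually) (auto simp: indicator_def)
  qed measurable
  define m where "m = f 1 - f 0"
  have "(d has_integral m) {0..1}"
    unfolding m_def using der
    by (intro fundamental_theorem_of_calculus) (auto simp: has_real_derivative_iff_has_vector_derivative)
  moreover have "set_integrable lborel {0..1} d"
    using int by (simp add: set_integrable_def)
  ultimately have "(LINT t:{0..1}|lborel. d t) = m"
    by (simp add: set_borel_integral_eq_integral(2) integral_unique)
  then have lm: "(LINT t|lborel. ?I t * d t) = m"
    by (simp add: set_lebesgue_integral_def)
  have I1: "integrable lborel ?I" "(LINT t|lborel. ?I t) = 1"
    by (auto simp: integrable_indicator_iff)
  have "exp m = (LINT t|lborel. exp m * ((1 - m) * ?I t + ?I t * d t))"
    using int I1 lm by simp
  also have "\<dots> \<le> (LINT t|lborel. ?I t * exp (d t))"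
  proof (rule integral_mono)
    show "integrable lborel (\<lambda>t. exp m * ((1 - m) * ?I t + ?I t * d t))"
      using int I1 by auto
    show "exp m * ((1 - m) * ?I t + ?I t * d t) \<le> ?I t * exp (d t)" for t
      using exp_ge_tangent[of m "d t"] by (auto simp: indicator_def algebra_simps)
  qed (rule int1)
  finally have "ennreal (exp m) \<le> ennreal (LINT t|lborel. ?I t * exp (d t))"
    by (rule ennreal_leI)
  also have "\<dots> = (\<integral>\<^sup>+t. ennreal (?I t * exp (d t)) \<partial>lborel)"
    using int1 by (intro nn_integral_eq_integral[symmetric]) auto
  also have "\<dots> = (\<integral>\<^sup>+t\<in>{0..1}. ennreal (exp (d t)) \<partial>lborel)"
    by (simp add: ennreal_mult' mult.commute ennreal_indicator)
  finally show ?thesis by (simp add: m_def)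
qed

text \<open>
  Jensen's inequality along the path, followed by an exchange of the integrals. The bound with the
  opposite sign is what makes the derivative integrable along almost every path.
\<close>

lemma exp_moment_increment_le_derivative:
  fixes f d :: "'y \<Rightarrow> real \<Rightarrow> real"
  assumes prob: "prob_space M"
    and meas: "\<And>t. t \<in> {0..1} \<Longrightarrow> (\<lambda>y. f y t) \<in> borel_measurable M"
    and der: "\<And>y t. y \<in> space M \<Longrightarrow> t \<in> {0..1} \<Longrightarrow> (f y has_real_derivative d y t) (at t within {0..1})"
    and bnd: "\<And>t. t \<in> {0..1} \<Longrightarrow> (\<integral>\<^sup>+y. ennreal (exp (d y t)) \<partial>M) \<le> ennreal C"
      "\<And>t. t \<in> {0..1} \<Longrightarrow> (\<integral>\<^sup>+y. ennreal (exp (- d y t)) \<partial>M) \<le> ennreal C"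
  shows "(\<integral>\<^sup>+y. ennreal (exp (f y 1 - f y 0)) \<partial>M) \<le> ennreal C"
proof -
  interpret prob_space M by fact
  have pair: "pair_sigma_finite M (lborel :: real measure)"
    by (intro pair_sigma_finite.intro sigma_finite_measure_axioms lborel.sigma_finite_measure_axioms)
  define F where "F y t = f y (max 0 (min 1 t))" for y t
  have F[measurable]: "(\<lambda>(y, t). F y t) \<in> borel_measurable (M \<Otimes>\<^sub>M lborel)"
  proof -
    have "continuous_on {0..1} (f y)" if "y \<in> space M" for y
      using DERIV_continuous_on[of "{0..1}" "f y", OF der[OF that]] .
    then have "continuous_on UNIV (F y)" if "y \<in> space M" for y
      unfolding F_def
      by (rule continuous_on_compose2[OF _ _ _]) (use that in \<open>auto intro!: continuous_intros\<close>)
    moreover have "(\<lambda>y. F y t) \<in> borel_measurable M" for t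
      unfolding F_def by (rule meas) auto
    ultimately have "(\<lambda>(y, t). F y t) \<in> borel_measurable (M \<Otimes>\<^sub>M borel)"
      by (intro borel_measurable_caratheodory) auto
    then show ?thesis by (simp cong: measurable_cong_sets)
  qed
  \<comment> \<open>The derivative as a limit of difference quotients, which makes it jointly measurable; it is
      the given derivative except possibly at the right end point, which is a null set.\<close>
  define D where "D y t = lim (\<lambda>n. real (Suc n) * (F y (t + 1 / real (Suc n)) - F y t))" for y t
  have D[measurable]: "(\<lambda>(y, t). D y t) \<in> borel_measurable (M \<Otimes>\<^sub>M lborel)"
  proof -
    have [measurable]: "(\<lambda>z. F (fst z) (snd z + c)) \<in> borel_measurable (M \<Otimes>\<^sub>M lborel)" for c
    proof -
      have "(\<lambda>z. (fst z, snd z + c)) \<in> M \<Otimes>\<^sub>M (lborel::real measure) \<rightarrow>\<^sub>M M \<Otimes>\<^sub>M (lborel :: real measure)"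
        by measurable
      from measurable_compose[OF this F] show ?thesis by simp
    qed
    have "(\<lambda>z. lim (\<lambda>n. real (Suc n) * (F (fst z) (snd z + 1 / real (Suc n)) - F (fst z) (snd z + 0))))
        \<in> borel_measurable (M \<Otimes>\<^sub>M lborel)"
      by measurable
    then show ?thesis by (simp add: D_def case_prod_beta')
  qed
  have Dd: "D y t = d y t" if y: "y \<in> space M" and t: "0 \<le> t" "t < 1" for y t
  proof -
    have *: "((\<lambda>s. (f y s - f y t) / (s - t)) \<longlongrightarrow> d y t) (at t within {0..1})"
      using der[OF y, of t] t by (simp add: has_field_derivative_iff)
    have ev: "\<forall>\<^sub>F n in sequentially. t + 1 / real (Suc n) < 1"
      using order_tendstoD(2)[OF tendsto_add[OF tendsto_const lim_1_over_n[THEN LIMSEQ_Suc], of t], of 1] t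
      by simp
    have "filterlim (\<lambda>n. t + 1 / real (Suc n)) (at t within {0..1}) sequentially"
      unfolding filterlim_at
    proof
      show "(\<lambda>n. t + 1 / real (Suc n)) \<longlonglongrightarrow> t"
        using tendsto_add[OF tendsto_const lim_1_over_n[THEN LIMSEQ_Suc], of t] by simp
      from ev show "\<forall>\<^sub>F n in sequentially. t + 1 / real (Suc n) \<in> {0..1} \<and> t + 1 / real (Suc n) \<noteq> t"
        by (rule eventually_mono) (use t in auto)
    qed
    note lim = filterlim_compose[OF * this]
    have "(\<lambda>n. real (Suc n) * (F y (t + 1 / real (Suc n)) - F y t)) \<longlonglongrightarrow> d y t"
      using lim
    proof (rule Lim_transform_eventually)
      show "\<forall>\<^sub>F n in sequentially. (f y (t + 1 / real (Suc n)) - f y t) / (t + 1 / real (Suc n) - t)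
          = real (Suc n) * (F y (t + 1 / real (Suc n)) - F y t)"
        using ev by eventually_elim (use t in \<open>simp add: F_def del: of_nat_Suc\<close>)
    qed
    then show ?thesis unfolding D_def by (rule limI)
  qed
  have ae1: "AE t in lborel. (t :: real) \<noteq> 1"
    using AE_lborel_singleton[of "1::real"] by simp
  have bound: "(\<integral>\<^sup>+y. (\<integral>\<^sup>+t\<in>{0..1}. ennreal (exp (c * D y t)) \<partial>lborel) \<partial>M) \<le> ennreal C"
    if c: "c = 1 \<or> c = -1" for c
  proof -
    have "(\<integral>\<^sup>+y. (\<integral>\<^sup>+t\<in>{0..1}. ennreal (exp (c * D y t)) \<partial>lborel) \<partial>M)
        = (\<integral>\<^sup>+t. (\<integral>\<^sup>+y. ennreal (exp (c * D y t)) * indicator {0..1} t \<partial>M) \<partial>lborel)"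
      by (rule pair_sigma_finite.Fubini'[OF pair, symmetric]) measurable
    also have "\<dots> \<le> (\<integral>\<^sup>+t. ennreal C * indicator {0..1::real} t \<partial>lborel)"
    proof (rule nn_integral_mono_AE)
      show "AE t in lborel. (\<integral>\<^sup>+y. ennreal (exp (c * D y t)) * indicator {0..1} t \<partial>M)
          \<le> ennreal C * indicator {0..1::real} t"
        using ae1
      proof eventually_elim
        case (elim t)
        show ?case
        proof (cases "t \<in> {0..1}")
          case True
          then have "(\<integral>\<^sup>+y. ennreal (exp (c * D y t)) * indicator {0..1} t \<partial>M)
              = (\<integral>\<^sup>+y. ennreal (exp (c * d y t)) \<partial>M)"
            using elim by (intro nn_integral_cong) (auto simp: Dd)
          with True bnd[OF True] c show ?thesis by auto
        qed simp
      qed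
    qed
    also have "\<dots> = ennreal C" by (simp add: nn_integral_cmult)
    finally show ?thesis .
  qed
  have fin: "AE y in M. (\<integral>\<^sup>+t\<in>{0..1}. ennreal (exp (c * D y t)) \<partial>lborel) < \<infinity>"
    if c: "c = 1 \<or> c = -1" for c
  proof -
    have "AE y in M. (\<integral>\<^sup>+t\<in>{0..1}. ennreal (exp (c * D y t)) \<partial>lborel) \<noteq> \<infinity>"
      using bound[OF c] by (intro nn_integral_PInf_AE) (measurable, auto simp: top_unique)
    then show ?thesis by (simp add: less_top)
  qed
  have "AE y in M. ennreal (exp (f y 1 - f y 0)) \<le> (\<integral>\<^sup>+t\<in>{0..1}. ennreal (exp (1 * D y t)) \<partial>lborel)"
    using fin[of 1, simplified] fin[of "-1", simplified] AE_space
  proof eventually_elim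
    case (elim y)
    have cong: "(\<integral>\<^sup>+t\<in>{0..1}. ennreal (exp (c * d y t)) \<partial>lborel) = (\<integral>\<^sup>+t\<in>{0..1}. ennreal (exp (c * D y t)) \<partial>lborel)" for c
      using ae1 by (intro nn_integral_cong_AE) (auto elim!: eventually_mono simp: indicator_def Dd elim(3))
    have [measurable]: "D y \<in> borel_measurable lborel"
      using measurable_compose[OF measurable_Pair1'[OF elim(3)] D] by simp
    have "(\<lambda>t. indicator {0..1} t * (if t = 1 then d y 1 else D y t)) \<in> borel_measurable lborel"
      by measurable
    also have "(\<lambda>t. indicator {0..1} t * (if t = 1 then d y 1 else D y t)) = (\<lambda>t. indicator {0..1} t * d y t)"
      using Dd[OF elim(3)] by (auto simp: indicator_def fun_eq_iff)
    finally have "set_borel_measurable lborel {0..1} (d y)"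
      by (simp add: set_borel_measurable_def)
    from jensen_exp_derivative[OF der[OF elim(3)] this]
    show ?case using elim cong[of 1] cong[of "-1"] by simp
  qed
  then have "(\<integral>\<^sup>+y. ennreal (exp (f y 1 - f y 0)) \<partial>M)
      \<le> (\<integral>\<^sup>+y. (\<integral>\<^sup>+t\<in>{0..1}. ennreal (exp (1 * D y t)) \<partial>lborel) \<partial>M)"
    by (rule nn_integral_mono_AE)
  also have "\<dots> \<le> ennreal C" by (rule bound) simp
  finally show ?thesis .
qed

section \<open>Chaining over dyadic nets\<close>

text \<open>
  Exponential moments of increments are at most those of a centred Gaussian variable with standard
  deviation \<sigma> times the distance, as long as the exponent times the distance stays below b. Distances are
  those of the images under e, so that the index set can keep its own coordinates.
\<close>

definition subexp_increments ::
    "'y measure \<Rightarrow> ('i \<Rightarrow> 'a::real_normed_vector) \<Rightarrow> real \<Rightarrow> real \<Rightarrow> 'i set \<Rightarrow> ('y \<Rightarrow> 'i \<Rightarrow> real) \<Rightarrow> bool"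
  where "subexp_increments M e \<sigma> b I X \<longleftrightarrow>
    (\<forall>i\<in>I. (\<lambda>y. X y i) \<in> borel_measurable M) \<and>
    (\<forall>i\<in>I. \<forall>j\<in>I. \<forall>s. \<bar>s\<bar> * norm (e i - e j) \<le> b \<longrightarrow>
      (\<integral>\<^sup>+y. ennreal (exp (s * (X y i - X y j))) \<partial>M) \<le> ennreal (exp (\<sigma>\<^sup>2 * (s * norm (e i - e j))\<^sup>2 / 2)))"

lemma subexp_incrementsD:
  assumes "subexp_increments M e \<sigma> b I X"
  shows "i \<in> I \<Longrightarrow> (\<lambda>y. X y i) \<in> borel_measurable M"
    and "i \<in> I \<Longrightarrow> j \<in> I \<Longrightarrow> \<bar>s\<bar> * norm (e i - e j) \<le> b \<Longrightarrow>
      (\<integral>\<^sup>+y. ennreal (exp (s * (X y i - X y j))) \<partial>M) \<le> ennreal (exp (\<sigma>\<^sup>2 * (s * norm (e i - e j))\<^sup>2 / 2))"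
  using assms unfolding subexp_increments_def by blast+

text \<open>
  The balls of radius s / 2 around the points are disjoint and lie in a ball of radius R + s / 2.
\<close>

lemma card_separated_le:
  fixes N :: "'a::euclidean_space set"
  assumes fin: "finite N" and sub: "N \<subseteq> cball 0 R" and s: "0 < s" and R: "0 \<le> R"
    and sep: "\<And>x y. x \<in> N \<Longrightarrow> y \<in> N \<Longrightarrow> x \<noteq> y \<Longrightarrow> s \<le> dist x y"
  shows "real (card N) \<le> (1 + 2 * R / s) ^ DIM('a)"
proof -
  let ?v = "unit_ball_vol (real DIM('a))"
  have "disjoint_family_on (\<lambda>x. ball x (s / 2)) N"
    unfolding disjoint_family_on_def
  proof (intro ballI impI)
    fix x y assume xy: "x \<in> N" "y \<in> N" "x \<noteq> y"
    then have d: "s \<le> dist x y" by (rule sep)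
    show "ball x (s / 2) \<inter> ball y (s / 2) = {}"
    proof (rule ccontr)
      assume "ball x (s / 2) \<inter> ball y (s / 2) \<noteq> {}"
      then obtain z where "dist x z < s / 2" "dist y z < s / 2" by auto
      then show False using d dist_triangle2[of x y z] by linarith
    qed
  qed
  then have "measure lborel (\<Union>x\<in>N. ball x (s / 2)) = (\<Sum>x\<in>N. measure lborel (ball x (s / 2)))"
    using fin by (intro measure_finite_Union) (auto simp: emeasure_ball s less_imp_le)
  also have "\<dots> = real (card N) * (?v * (s / 2) ^ DIM('a))"
    using s by (simp add: content_ball)
  finally have "real (card N) * (?v * (s / 2) ^ DIM('a)) = measure lborel (\<Union>x\<in>N. ball x (s / 2))" ..
  also have "\<dots> \<le> measure lborel (ball (0::'a) (R + s / 2))"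
  proof (rule measure_mono_fmeasurable)
    have "open (\<Union>x\<in>N. ball x (s / 2))" by auto
    then show "(\<Union>x\<in>N. ball x (s / 2)) \<in> sets lborel" by simp
    show "(\<Union>x\<in>N. ball x (s / 2)) \<subseteq> ball 0 (R + s / 2)"
    proof
      fix z assume "z \<in> (\<Union>x\<in>N. ball x (s / 2))"
      then obtain x where "x \<in> N" "dist x z < s / 2" by auto
      then show "z \<in> ball 0 (R + s / 2)"
        using sub norm_triangle_ineq2[of z x] by (force simp: dist_norm norm_minus_commute)
    qed
  qed (auto simp: emeasure_ball R s less_imp_le intro!: fmeasurableI)
  also have "\<dots> = ?v * (R + s / 2) ^ DIM('a)"
    using s R by (simp add: content_ball)
  finally have "real (card N) * (s / 2) ^ DIM('a) * ?v \<le> (R + s / 2) ^ DIM('a) * ?v"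
    by (simp add: mult_ac)
  then have "real (card N) * (s / 2) ^ DIM('a) \<le> (R + s / 2) ^ DIM('a)"
    by (simp add: mult_le_cancel_right)
  then have "real (card N) \<le> ((R + s / 2) / (s / 2)) ^ DIM('a)"
    using s by (subst power_divide) (simp add: pos_le_divide_eq)
  also have "(R + s / 2) / (s / 2) = 1 + 2 * R / s"
    using s by (simp add: field_simps)
  finally show ?thesis .
qed

lemma finite_net_exists:
  fixes e :: "'i \<Rightarrow> 'a::real_normed_vector"
  assumes "finite F" and "0 < s"
  shows "\<exists>N\<subseteq>F. (\<forall>i\<in>F. \<exists>j\<in>N. norm (e i - e j) < s) \<and>
    (\<forall>i\<in>N. \<forall>j\<in>N. i \<noteq> j \<longrightarrow> s \<le> norm (e i - e j))"
  using assms(1)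
proof (induction F)
  case (insert i F)
  then obtain N where N: "N \<subseteq> F" "\<forall>i\<in>F. \<exists>j\<in>N. norm (e i - e j) < s"
    "\<forall>i\<in>N. \<forall>j\<in>N. i \<noteq> j \<longrightarrow> s \<le> norm (e i - e j)" by auto
  show ?case
  proof (cases "\<exists>j\<in>N. norm (e i - e j) < s")
    case True
    with N show ?thesis by (intro exI[of _ N]) auto
  next
    case False
    with N \<open>0 < s\<close> show ?thesis
      by (intro exI[of _ "insert i N"]) (auto simp: norm_minus_commute not_less)
  qed
qed simp

text \<open>
  Convexity of the exponential, where the missing weight sits at the point 0.
\<close>

lemma exp_sum_le_weighted:
  fixes a x :: "'k \<Rightarrow> real"
  assumes "\<And>k. k \<in> A \<Longrightarrow> 0 \<le> a k" and "sum a A \<le> 1"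
  shows "exp (\<Sum>k\<in>A. a k * x k) \<le> (\<Sum>k\<in>A. a k * exp (x k)) + (1 - sum a A)"
proof -
  define m where "m = (\<Sum>k\<in>A. a k * x k)"
  have "exp m = (\<Sum>k\<in>A. a k * (exp m * (1 + (x k - m)))) + (1 - sum a A) * (exp m * (1 + (0 - m)))"
    by (simp add: m_def[symmetric] algebra_simps sum.distrib sum_subtractf sum_distrib_left[symmetric]
        sum_distrib_right[symmetric])
  also have "\<dots> \<le> (\<Sum>k\<in>A. a k * exp (x k)) + (1 - sum a A) * exp 0"
    using assms by (intro add_mono sum_mono mult_left_mono exp_ge_tangent) auto
  finally show ?thesis by (simp add: m_def)
qed

lemma chaining_entropy_sum: "(\<Sum>m\<le>K. (real m + 3) / 2 ^ Suc m) = 4 - (real K + 5) / 2 ^ Suc K"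
  by (induction K) (simp_all add: field_simps)

lemma chaining_weight_sum: "(\<Sum>m\<le>K. 1 / 2 ^ Suc m :: real) = 1 - 1 / 2 ^ Suc K"
  by (induction K) (simp_all add: field_simps)

text \<open>
  Each point of F is reached from the base point through nearby points in nets of radii
  R / 2^(m+1). A link at level m has length at most R / 2^m. The weights 1 / 2^(m+1) of the
  links are chosen proportional to these lengths, so that every scaled link has the same
  exponential moment, and convexity of the exponential replaces the product over the links of a
  chain by a weighted sum. Summing over all links of all levels, each level normalised by its
  number of points, gives a single random variable B of mean at most 1 that serves all points of F
  at once. On a finite set the nets are eventually the whole set, so that the chains are finite.
\<close>

lemma chaining_bound:
  fixes e :: "'i \<Rightarrow> 'a::euclidean_space"
  assumes inc: "subexp_increments M e \<sigma> b (insert i0 F) X"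
    and prob: "prob_space M" and fin: "finite F" and inj: "inj_on e F"
    and e0: "e i0 = 0" and X0: "\<And>y. y \<in> space M \<Longrightarrow> X y i0 = 0"
    and R: "0 < R" and FR: "\<And>i. i \<in> F \<Longrightarrow> norm (e i) \<le> R"
    and \<mu>: "0 \<le> \<mu>" "2 * \<mu> \<le> b"
  obtains B where "B \<in> borel_measurable M" "(\<integral>\<^sup>+y. B y \<partial>M) \<le> 1"
    "\<And>y i. y \<in> space M \<Longrightarrow> i \<in> F \<Longrightarrow>
      ennreal (exp (\<mu> * X y i / R - (4 * ln 2 * real DIM('a) + 2 * \<sigma>\<^sup>2 * \<mu>\<^sup>2))) \<le> B y"
proof -
  interpret prob_space M by fact
  define len where "len m = R / 2 ^ m" for m :: nat
  have len: "0 < len m" for m using R by (simp add: len_def)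
  have "\<exists>N\<subseteq>F. (\<forall>i\<in>F. \<exists>j\<in>N. norm (e i - e j) < len (Suc m)) \<and>
      (\<forall>i\<in>N. \<forall>j\<in>N. i \<noteq> j \<longrightarrow> len (Suc m) \<le> norm (e i - e j))" for m
    using fin len by (rule finite_net_exists)
  then obtain N where N: "\<And>m. N m \<subseteq> F"
    and cover: "\<And>m. \<forall>i\<in>F. \<exists>j\<in>N m. norm (e i - e j) < len (Suc m)"
    and sep: "\<And>m i j. i \<in> N m \<Longrightarrow> j \<in> N m \<Longrightarrow> i \<noteq> j \<Longrightarrow> len (Suc m) \<le> norm (e i - e j)"
    by metis
  from cover obtain \<pi> where \<pi>: "\<And>m i. i \<in> F \<Longrightarrow> \<pi> m i \<in> N m"
    "\<And>m i. i \<in> F \<Longrightarrow> norm (e i - e (\<pi> m i)) < len (Suc m)"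
    by metis
  have finN: "finite (N m)" for m using N fin finite_subset by blast
  have cardN: "real (card (N m)) \<le> exp ((real m + 3) * ln 2 * real DIM('a))" for m
  proof -
    have "real (card (N m)) = real (card (e ` N m))"
      using inj N by (metis card_image inj_on_subset)
    also have "\<dots> \<le> (1 + 2 * R / len (Suc m)) ^ DIM('a)"
    proof (rule card_separated_le)
      show "e ` N m \<subseteq> cball 0 R" using N FR by (auto simp: subset_iff)
      show "len (Suc m) \<le> dist x y" if "x \<in> e ` N m" "y \<in> e ` N m" "x \<noteq> y" for x y
        using that sep by (auto simp: dist_norm)
    qed (use finN len R in auto)
    also have "1 + 2 * R / len (Suc m) = 1 + 2 ^ (m + 2)"
      using R by (simp add: len_def field_simps)
    also have "(1 + 2 ^ (m + 2)) ^ DIM('a) \<le> (2 ^ (m + 3) :: real) ^ DIM('a)"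
    proof (rule power_mono)
      have "(1::real) \<le> 2 ^ (m + 2)" by (rule one_le_power) simp
      moreover have "(2::real) ^ (m + 3) = 2 ^ (m + 2) + 2 ^ (m + 2)" by (simp add: power_add)
      ultimately show "1 + 2 ^ (m + 2) \<le> (2 ^ (m + 3) :: real)" by linarith
    qed simp
    also have "\<dots> = exp (real DIM('a) * (real (m + 3) * ln 2))"
      by (simp only: exp_of_nat_mult exp_ln zero_less_numeral)
    finally show ?thesis by (simp add: mult_ac add_ac)
  qed
  \<comment> \<open>Below the least distance between points of F a net contains every point.\<close>
  obtain K where K: "\<And>i. i \<in> F \<Longrightarrow> i \<in> N K"
  proof -
    have "(\<lambda>m. len (Suc m)) \<longlonglongrightarrow> 0"
      unfolding len_def by (rule LIMSEQ_Suc, rule LIMSEQ_divide_realpow_zero) simp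
    then have "\<forall>\<^sub>F m in sequentially. \<forall>i\<in>F. \<forall>j\<in>F. i \<noteq> j \<longrightarrow> len (Suc m) < norm (e i - e j)"
      using inj fin
      by (intro eventually_ball_finite ballI) (auto simp: inj_on_def intro!: order_tendstoD(2))
    then obtain m where "\<And>i j. i \<in> F \<Longrightarrow> j \<in> F \<Longrightarrow> i \<noteq> j \<Longrightarrow> len (Suc m) < norm (e i - e j)"
      using eventually_happens' sequentially_bot by blast
    then have "\<pi> m i = i" if "i \<in> F" for i
      using \<pi>[OF that, of m] N that by (metis not_less_iff_gr_or_eq subsetD)
    then show ?thesis using \<pi>(1) that by metis
  qed
  \<comment> \<open>The predecessor of a net point in its chain.\<close>
  define pr where "pr m j = (case m of 0 \<Rightarrow> i0 | Suc k \<Rightarrow> \<pi> k j)" for m j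
  have pr_simps: "pr 0 j = i0" "pr (Suc k) j = \<pi> k j" for k j by (simp_all add: pr_def)
  have prF: "pr m j \<in> insert i0 F" if "j \<in> N m" for m j
    using that \<pi>(1) N by (auto simp: pr_def split: nat.split)
  have link: "norm (e j - e (pr m j)) \<le> len m" if "j \<in> N m" for m j
    using that N FR e0 \<pi>(2) by (auto simp: pr_def len_def subset_iff less_imp_le split: nat.split)
  have path: "\<exists>j. (\<forall>m\<le>k. j m \<in> N m) \<and> X y i = (\<Sum>m\<le>k. X y (j m) - X y (pr m (j m)))"
    if y: "y \<in> space M" and "i \<in> N k" for y i k
    using that(2)
  proof (induction k arbitrary: i)
    case 0
    then show ?case using X0[OF y] by (intro exI[of _ "\<lambda>_. i"]) (simp add: pr_simps)
  next
    case (Suc k)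
    then have "\<pi> k i \<in> N k" using \<pi> N by blast
    from Suc.IH[OF this] obtain j where j: "\<forall>m\<le>k. j m \<in> N m"
      "X y (\<pi> k i) = (\<Sum>m\<le>k. X y (j m) - X y (pr m (j m)))" by blast
    have "(\<Sum>m\<le>k. X y ((j(Suc k := i)) m) - X y (pr m ((j(Suc k := i)) m)))
        = (\<Sum>m\<le>k. X y (j m) - X y (pr m (j m)))"
      by (intro sum.cong) auto
    then show ?case
      using j Suc.prems by (intro exI[of _ "j(Suc k := i)"]) (auto simp: pr_simps le_Suc_eq)
  qed
  define E where "E m y j = 2 * \<mu> / len m * (X y j - X y (pr m j))" for m y j
  define c where "c m = 2 * \<sigma>\<^sup>2 * \<mu>\<^sup>2 + (real m + 3) * ln 2 * real DIM('a)" for m :: nat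
  define a :: "nat \<Rightarrow> real" where "a m = 1 / 2 ^ Suc m" for m :: nat
  have a: "0 \<le> a m" for m by (simp add: a_def)
  have asum: "sum a {..K} = 1 - a K" unfolding a_def by (rule chaining_weight_sum)
  define B where "B y = (\<Sum>m\<le>K. \<Sum>j\<in>N m. ennreal (a m * exp (E m y j - c m))) + ennreal (a K)" for y
  have X[measurable]: "(\<lambda>y. X y i) \<in> borel_measurable M" if "i \<in> insert i0 F" for i
    using subexp_incrementsD(1)[OF inc that] .
  have Em: "(\<lambda>y. E m y j) \<in> borel_measurable M" if "j \<in> N m" for m j
    unfolding E_def using that prF[OF that] N[of m]
    by (intro borel_measurable_times borel_measurable_diff borel_measurable_const X) auto
  have Bm: "(\<lambda>y. ennreal (a m * exp (E m y j - c m))) \<in> borel_measurable M" if "j \<in> N m" for m j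
    using Em[OF that] by measurable
  have Eint: "(\<integral>\<^sup>+y. ennreal (a m * exp (E m y j - c m)) \<partial>M)
      \<le> ennreal (a m * exp (- ((real m + 3) * ln 2 * real DIM('a))))" if j: "j \<in> N m" for m j
  proof -
    let ?n = "norm (e j - e (pr m j))"
    have n: "2 * \<mu> / len m * ?n \<le> 2 * \<mu>"
      using link[OF j] \<mu> len[of m] by (simp add: divide_le_eq mult_left_mono)
    have "(\<integral>\<^sup>+y. ennreal (exp (E m y j)) \<partial>M) \<le> ennreal (exp (\<sigma>\<^sup>2 * (2 * \<mu> / len m * ?n)\<^sup>2 / 2))"
      unfolding E_def using j N[of m] prF[OF j] n \<mu> len[of m]
      by (intro subexp_incrementsD(2)[OF inc]) auto
    also have "\<dots> \<le> ennreal (exp (2 * \<sigma>\<^sup>2 * \<mu>\<^sup>2))"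
    proof -
      have "(2 * \<mu> / len m * ?n)\<^sup>2 \<le> (2 * \<mu>)\<^sup>2"
        using n \<mu> len[of m] by (intro power_mono) auto
      from mult_left_mono[OF this, of "\<sigma>\<^sup>2"] show ?thesis
        by (intro ennreal_leI) (simp add: power_mult_distrib mult_ac)
    qed
    finally have *: "(\<integral>\<^sup>+y. ennreal (exp (E m y j)) \<partial>M) \<le> ennreal (exp (2 * \<sigma>\<^sup>2 * \<mu>\<^sup>2))" .
    have "(\<integral>\<^sup>+y. ennreal (a m * exp (E m y j - c m)) \<partial>M)
        = (\<integral>\<^sup>+y. ennreal (a m * exp (- c m)) * ennreal (exp (E m y j)) \<partial>M)"
      using a[of m] by (intro nn_integral_cong)
        (simp add: ennreal_mult[symmetric] exp_diff exp_minus field_simps)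
    also have "\<dots> = ennreal (a m * exp (- c m)) * (\<integral>\<^sup>+y. ennreal (exp (E m y j)) \<partial>M)"
      using Em[OF j] by (intro nn_integral_cmult) measurable
    also have "\<dots> \<le> ennreal (a m * exp (- c m)) * ennreal (exp (2 * \<sigma>\<^sup>2 * \<mu>\<^sup>2))"
      using * by (rule mult_left_mono) simp
    also have "\<dots> = ennreal (a m * (exp (- c m) * exp (2 * \<sigma>\<^sup>2 * \<mu>\<^sup>2)))"
      using a[of m] by (simp add: ennreal_mult[symmetric] mult_ac)
    also have "exp (- c m) * exp (2 * \<sigma>\<^sup>2 * \<mu>\<^sup>2) = exp (- ((real m + 3) * ln 2 * real DIM('a)))"
      by (simp add: c_def mult_exp_exp)
    finally show ?thesis .
  qed
  show ?thesis
  proof (rule that)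
    show "B \<in> borel_measurable M"
      unfolding B_def by (intro borel_measurable_add borel_measurable_sum borel_measurable_const Bm)
    have "(\<integral>\<^sup>+y. B y \<partial>M)
        = (\<Sum>m\<le>K. \<Sum>j\<in>N m. \<integral>\<^sup>+y. ennreal (a m * exp (E m y j - c m)) \<partial>M) + ennreal (a K)"
      unfolding B_def using Bm
      by (subst nn_integral_add) (auto simp: nn_integral_sum emeasure_space_1)
    also have "\<dots> \<le> (\<Sum>m\<le>K. ennreal (a m)) + ennreal (a K)"
    proof (intro add_mono sum_mono order_refl)
      fix m
      have "(\<Sum>j\<in>N m. \<integral>\<^sup>+y. ennreal (a m * exp (E m y j - c m)) \<partial>M)
          \<le> (\<Sum>j\<in>N m. ennreal (a m * exp (- ((real m + 3) * ln 2 * real DIM('a)))))"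
        by (intro sum_mono Eint)
      also have "\<dots> = ennreal (a m * (real (card (N m)) * exp (- ((real m + 3) * ln 2 * real DIM('a)))))"
        using a[of m] by (simp add: ennreal_of_nat_eq_real_of_nat ennreal_mult[symmetric] mult_ac)
      also have "\<dots> \<le> ennreal (a m)"
      proof (rule ennreal_leI)
        have "real (card (N m)) * exp (- ((real m + 3) * ln 2 * real DIM('a)))
           \<le> exp ((real m + 3) * ln 2 * real DIM('a)) * exp (- ((real m + 3) * ln 2 * real DIM('a)))"
          by (intro mult_right_mono cardN) simp
        also have "\<dots> = 1" by (simp add: mult_exp_exp)
        finally show "a m * (real (card (N m)) * exp (- ((real m + 3) * ln 2 * real DIM('a)))) \<le> a m"
          using a[of m] by (simp add: mult_left_le)
      qed
      finally show "(\<Sum>j\<in>N m. \<integral>\<^sup>+y. ennreal (a m * exp (E m y j - c m)) \<partial>M) \<le> ennreal (a m)" .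
    qed
    also have "\<dots> = ennreal (sum a {..K} + a K)"
      using a by (simp add: sum_ennreal sum_nonneg)
    also have "\<dots> = 1" by (simp add: asum)
    finally show "(\<integral>\<^sup>+y. B y \<partial>M) \<le> 1" .
  next
    fix y i assume y: "y \<in> space M" and "i \<in> F"
    from path[OF y K[OF this(2)]] obtain j where j: "\<And>m. m \<le> K \<Longrightarrow> j m \<in> N m"
      and Xi: "X y i = (\<Sum>m\<le>K. X y (j m) - X y (pr m (j m)))" by blast
    have aE: "a m * E m y (j m) = \<mu> / R * (X y (j m) - X y (pr m (j m)))" for m
      using R by (simp add: a_def E_def len_def)
    have "(\<Sum>m\<le>K. a m * E m y (j m)) = \<mu> / R * X y i"
      unfolding aE Xi by (simp only: sum_distrib_left)
    then have "(\<Sum>m\<le>K. a m * (E m y (j m) - c m)) = \<mu> * X y i / R - (\<Sum>m\<le>K. a m * c m)"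
      by (simp add: right_diff_distrib sum_subtractf)
    moreover have "(\<Sum>m\<le>K. a m * c m) \<le> 4 * ln 2 * real DIM('a) + 2 * \<sigma>\<^sup>2 * \<mu>\<^sup>2"
    proof -
      have "a m * c m = 2 * \<sigma>\<^sup>2 * \<mu>\<^sup>2 * a m + ln 2 * real DIM('a) * ((real m + 3) / 2 ^ Suc m)" for m
        unfolding c_def a_def by (simp add: field_simps del: power_Suc)
      then have "(\<Sum>m\<le>K. a m * c m) = 2 * \<sigma>\<^sup>2 * \<mu>\<^sup>2 * sum a {..K}
          + ln 2 * real DIM('a) * (\<Sum>m\<le>K. (real m + 3) / 2 ^ Suc m)"
        by (simp only: sum.distrib sum_distrib_left)
      also have "\<dots> \<le> 2 * \<sigma>\<^sup>2 * \<mu>\<^sup>2 * 1 + ln 2 * real DIM('a) * 4"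
        unfolding asum chaining_entropy_sum using a[of K]
        by (intro add_mono mult_left_mono) auto
      finally show ?thesis by (simp add: mult_ac)
    qed
    ultimately have "exp (\<mu> * X y i / R - (4 * ln 2 * real DIM('a) + 2 * \<sigma>\<^sup>2 * \<mu>\<^sup>2))
        \<le> exp (\<Sum>m\<le>K. a m * (E m y (j m) - c m))" by simp
    also have "\<dots> \<le> (\<Sum>m\<le>K. a m * exp (E m y (j m) - c m)) + a K"
      using exp_sum_le_weighted[of "{..K}" a "\<lambda>m. E m y (j m) - c m"] a[of K] a by (simp add: asum)
    finally have "ennreal (exp (\<mu> * X y i / R - (4 * ln 2 * real DIM('a) + 2 * \<sigma>\<^sup>2 * \<mu>\<^sup>2)))
        \<le> ennreal ((\<Sum>m\<le>K. a m * exp (E m y (j m) - c m)) + a K)" by (rule ennreal_leI)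
    also have "\<dots> = (\<Sum>m\<le>K. ennreal (a m * exp (E m y (j m) - c m))) + ennreal (a K)"
      using a by (simp add: sum_ennreal sum_nonneg)
    also have "\<dots> \<le> B y"
      unfolding B_def
    proof (intro add_mono sum_mono order_refl)
      fix m assume "m \<in> {..K}"
      then show "ennreal (a m * exp (E m y (j m) - c m)) \<le> (\<Sum>j\<in>N m. ennreal (a m * exp (E m y j - c m)))"
        using j finN by (intro member_le_sum) auto
    qed
    finally show "ennreal (exp (\<mu> * X y i / R - (4 * ln 2 * real DIM('a) + 2 * \<sigma>\<^sup>2 * \<mu>\<^sup>2))) \<le> B y" .
  qed
qed

text \<open>
  Markov's inequality for the random variable that serves all points of F.
\<close>

lemma sup_tail_bound:
  fixes e :: "'i \<Rightarrow> 'a::euclidean_space"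
  assumes inc: "subexp_increments M e \<sigma> b (insert i0 F) X"
    and prob: "prob_space M" and fin: "finite F" and inj: "inj_on e F"
    and e0: "e i0 = 0" and X0: "\<And>y. y \<in> space M \<Longrightarrow> X y i0 = 0"
    and R: "0 < R" and FR: "\<And>i. i \<in> F \<Longrightarrow> norm (e i) \<le> R"
    and \<mu>: "0 \<le> \<mu>" "2 * \<mu> \<le> b"
  shows "measure M {y \<in> space M. \<exists>i\<in>F. t \<le> X y i / R}
    \<le> exp (4 * ln 2 * real DIM('a) + 2 * \<sigma>\<^sup>2 * \<mu>\<^sup>2 - \<mu> * t)"
proof -
  interpret prob_space M by fact
  let ?C = "4 * ln 2 * real DIM('a) + 2 * \<sigma>\<^sup>2 * \<mu>\<^sup>2"
  obtain B where B[measurable]: "B \<in> borel_measurable M" and B1: "(\<integral>\<^sup>+y. B y \<partial>M) \<le> 1"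
    and le: "\<And>y i. y \<in> space M \<Longrightarrow> i \<in> F \<Longrightarrow> ennreal (exp (\<mu> * X y i / R - ?C)) \<le> B y"
    using chaining_bound[OF assms] by blast
  have sub: "{y \<in> space M. \<exists>i\<in>F. t \<le> X y i / R} \<subseteq> {y \<in> space M. 1 \<le> ennreal (exp (?C - \<mu> * t)) * B y}"
  proof safe
    fix y i assume y: "y \<in> space M" "i \<in> F" "t \<le> X y i / R"
    have "1 \<le> exp (?C - \<mu> * t) * exp (\<mu> * X y i / R - ?C)"
      using mult_left_mono[OF y(3) \<mu>(1)] by (simp add: mult_exp_exp)
    then have "1 \<le> ennreal (exp (?C - \<mu> * t)) * ennreal (exp (\<mu> * X y i / R - ?C))"
      by (simp add: ennreal_mult[symmetric] ennreal_leI flip: ennreal_1)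
    also have "\<dots> \<le> ennreal (exp (?C - \<mu> * t)) * B y"
      by (intro mult_left_mono le y) simp
    finally show "1 \<le> ennreal (exp (?C - \<mu> * t)) * B y" .
  qed
  have "emeasure M {y \<in> space M. \<exists>i\<in>F. t \<le> X y i / R}
      \<le> emeasure M {y \<in> space M. 1 \<le> ennreal (exp (?C - \<mu> * t)) * B y}"
    using sub by (rule emeasure_mono) measurable
  also have "\<dots> \<le> ennreal (exp (?C - \<mu> * t)) * (\<integral>\<^sup>+y. B y * indicator (space M) y \<partial>M)"
    using nn_integral_Markov_inequality[of B "space M" M "ennreal (exp (?C - \<mu> * t))"] by simp
  also have "(\<integral>\<^sup>+y. B y * indicator (space M) y \<partial>M) = (\<integral>\<^sup>+y. B y \<partial>M)"
    by (intro nn_integral_cong) simp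
  also have "ennreal (exp (?C - \<mu> * t)) * (\<integral>\<^sup>+y. B y \<partial>M) \<le> ennreal (exp (?C - \<mu> * t)) * 1"
    using B1 by (rule mult_left_mono) simp
  finally show ?thesis
    by (simp add: emeasure_eq_measure)
qed

section \<open>Quadratic penalty and slicing\<close>

text \<open>
  From n to n + 1 the sum of the two powers grows at least as much as from 0 to 1.
\<close>

lemma reciprocal_power_sum_ge:
  fixes q :: real
  assumes q: "1 < q"
  shows "1 + real n * ((q - 1)\<^sup>2 / (2 * q)) \<le> (q ^ n + inverse q ^ n) / 2"
proof (induction n)
  case (Suc n)
  have "1 \<le> q ^ n" "inverse q ^ n \<le> 1"
    using q by (auto intro!: one_le_power power_le_one simp: inverse_le_1_iff)
  then have "q ^ n - inverse q * inverse q ^ n \<ge> 1 - inverse q * 1"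
    using q by (intro diff_mono mult_left_mono) auto
  then have "(q - 1) * (1 - inverse q) \<le> (q - 1) * (q ^ n - inverse q * inverse q ^ n)"
    using q by (intro mult_left_mono) auto
  also have "\<dots> = (q ^ Suc n + inverse q ^ Suc n) - (q ^ n + inverse q ^ n)"
    using q by (simp add: algebra_simps)
  finally have "(q - 1) * (1 - inverse q) / 2 \<le> ((q ^ Suc n + inverse q ^ Suc n) - (q ^ n + inverse q ^ n)) / 2"
    by simp
  moreover have "(q - 1) * (1 - inverse q) / 2 = (q - 1)\<^sup>2 / (2 * q)"
    using q by (simp add: field_simps power2_eq_square)
  ultimately have "(1 + real n * ((q - 1)\<^sup>2 / (2 * q))) + (q - 1)\<^sup>2 / (2 * q)
      \<le> (q ^ n + inverse q ^ n) / 2 + ((q ^ Suc n + inverse q ^ Suc n) - (q ^ n + inverse q ^ n)) / 2"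
    using Suc by (intro add_mono) auto
  also have "\<dots> = (q ^ Suc n + inverse q ^ Suc n) / 2"
    by (simp add: diff_divide_distrib del: power_Suc)
  finally show ?case
    by (simp add: distrib_right add_divide_distrib del: power_Suc)
qed simp

lemma sum_geometric_int_le:
  fixes r :: real
  assumes fin: "finite J" and r: "0 \<le> r" "r < 1"
  shows "(\<Sum>j\<in>J. r ^ nat \<bar>j :: int\<bar>) \<le> 2 / (1 - r)"
proof -
  have half: "(\<Sum>j\<in>A. r ^ nat \<bar>j\<bar>) \<le> 1 / (1 - r)"
    if A: "finite A" and inj: "inj_on (\<lambda>j::int. nat \<bar>j\<bar>) A" for A
  proof -
    have "(\<Sum>j\<in>A. r ^ nat \<bar>j\<bar>) = (\<Sum>n\<in>(\<lambda>j. nat \<bar>j\<bar>) ` A. r ^ n)"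
      using inj by (simp add: sum.reindex)
    also have "\<dots> \<le> (\<Sum>n. r ^ n)"
      using A r by (intro sum_le_suminf summable_geometric) auto
    also have "\<dots> = 1 / (1 - r)" using r by (simp add: suminf_geometric)
    finally show ?thesis .
  qed
  have "(\<Sum>j\<in>J. r ^ nat \<bar>j\<bar>) = (\<Sum>j\<in>J \<inter> {0..}. r ^ nat \<bar>j\<bar>) + (\<Sum>j\<in>J - {0..}. r ^ nat \<bar>j\<bar>)"
    using fin by (rule sum.Int_Diff)
  also have "\<dots> \<le> 1 / (1 - r) + 1 / (1 - r)"
    using fin by (intro add_mono half) (auto simp: inj_on_def)
  finally show ?thesis by simp
qed

text \<open>
  The number a is the minimum over R of z / R + R / (2 q^2), attained at R = q sqrt (2 z). The
  shell of index j has outer radius q^j times this minimiser, and there the threshold is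
  a (q^j + q^(-j)) / 2, which exceeds a by at least the fraction \<kappa> for each unit of the absolute
  value of j. The same exponent \<mu> is used on all shells, so that the bounds for the shells form
  a geometric series in both directions.
\<close>

lemma penalized_tail_finite:
  fixes e :: "'i \<Rightarrow> 'a::euclidean_space" and q z \<mu> :: real
  defines "a \<equiv> sqrt (2 * z) / q" and "\<kappa> \<equiv> (q - 1)\<^sup>2 / (2 * q)"
  assumes inc: "subexp_increments M e \<sigma> b (insert i0 F) X"
    and prob: "prob_space M" and fin: "finite F" and inj: "inj_on e (insert i0 F)"
    and e0: "e i0 = 0" and X0: "\<And>y. y \<in> space M \<Longrightarrow> X y i0 = 0"
    and \<mu>: "0 < \<mu>" "2 * \<mu> \<le> b" and z: "0 < z" and q: "1 < q"
  shows "measure M {y \<in> space M. \<exists>i\<in>F. z \<le> X y i - (norm (e i))\<^sup>2 / 2}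
    \<le> exp (4 * ln 2 * real DIM('a) + 2 * \<sigma>\<^sup>2 * \<mu>\<^sup>2 - \<mu> * a) * (2 / (1 - exp (- \<mu> * a * \<kappa>)))"
proof -
  interpret prob_space M by fact
  have a: "0 < a" and \<kappa>: "0 < \<kappa>" using z q by (auto simp: a_def \<kappa>_def)
  \<comment> \<open>Outer radii of the shells; the shell of a point is determined by rounding up a logarithm.\<close>
  define R where "R j = q * sqrt (2 * z) * q powr real_of_int j" for j
  have R: "0 < R j" for j using z q by (simp add: R_def)
  define C where "C = 4 * ln 2 * real DIM('a) + 2 * \<sigma>\<^sup>2 * \<mu>\<^sup>2"
  define r where "r = exp (- \<mu> * a * \<kappa>)"
  have r: "0 \<le> r" "r < 1" using \<mu> a \<kappa> by (auto simp: r_def)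
  define idx where "idx i = \<lceil>log q (norm (e i) / (q * sqrt (2 * z)))\<rceil>" for i
  have idx: "norm (e i) \<le> R (idx i)" "R (idx i) / q \<le> norm (e i)" if "e i \<noteq> 0" for i
  proof -
    define u where "u = norm (e i) / (q * sqrt (2 * z))"
    have u: "0 < u" using that z q by (simp add: u_def)
    have n: "norm (e i) = q * sqrt (2 * z) * u" using z q by (simp add: u_def)
    have "log q u \<le> real_of_int (idx i)" "real_of_int (idx i) \<le> log q u + 1"
      unfolding idx_def u_def[symmetric] by linarith+
    then have "q powr log q u \<le> q powr real_of_int (idx i)" "q powr real_of_int (idx i) \<le> q powr (log q u + 1)"
      using q by (auto intro: powr_mono)
    then have "u \<le> q powr real_of_int (idx i)" "q powr real_of_int (idx i) \<le> q * u"
      using q u by (auto simp: powr_add mult.commute)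
    then show "norm (e i) \<le> R (idx i)" "R (idx i) / q \<le> norm (e i)"
      unfolding n R_def using q z by (auto simp: divide_le_eq mult_ac)
  qed
  define Fj where "Fj j = {i \<in> F. e i \<noteq> 0 \<and> idx i = j}" for j
  define Ev where "Ev j = {y \<in> space M. \<exists>i\<in>Fj j. a * (1 + real (nat \<bar>j\<bar>) * \<kappa>) \<le> X y i / R j}" for j
  have Ev_sets: "Ev j \<in> sets M" for j
  proof -
    have "finite (Fj j)" using fin by (simp add: Fj_def)
    moreover have "(\<lambda>y. X y i) \<in> borel_measurable M" if "i \<in> Fj j" for i
      using that by (intro subexp_incrementsD(1)[OF inc]) (auto simp: Fj_def)
    ultimately show ?thesis
      unfolding Ev_def by (intro sets.sets_Collect_finite_Ex) measurable
  qed
  have Ev_prob: "prob (Ev j) \<le> exp (C - \<mu> * a) * r ^ nat \<bar>j\<bar>" for j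
  proof -
    have sub: "insert i0 (Fj j) \<subseteq> insert i0 F" by (auto simp: Fj_def)
    have "prob (Ev j) \<le> exp (C - \<mu> * (a * (1 + real (nat \<bar>j\<bar>) * \<kappa>)))"
      unfolding Ev_def C_def
    proof (rule sup_tail_bound[OF _ prob])
      show "subexp_increments M e \<sigma> b (insert i0 (Fj j)) X"
        using inc sub unfolding subexp_increments_def by blast
      show "inj_on e (Fj j)" using inj sub by (auto intro: inj_on_subset)
      show "norm (e i) \<le> R j" if "i \<in> Fj j" for i
        using that idx(1) by (auto simp: Fj_def)
    qed (use fin e0 X0 R \<mu> in \<open>auto simp: Fj_def\<close>)
    also have "\<dots> = exp (C - \<mu> * a) * r ^ nat \<bar>j\<bar>"
      by (simp add: r_def exp_of_nat_mult[symmetric] mult_exp_exp algebra_simps)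
    finally show ?thesis .
  qed
  define J where "J = idx ` F"
  have sub: "{y \<in> space M. \<exists>i\<in>F. z \<le> X y i - (norm (e i))\<^sup>2 / 2} \<subseteq> (\<Union>j\<in>J. Ev j)"
  proof safe
    fix y i assume y: "y \<in> space M" and i: "i \<in> F" and zi: "z \<le> X y i - (norm (e i))\<^sup>2 / 2"
    \<comment> \<open>The base point lies in no shell, but the process vanishes there and the level is positive.\<close>
    have nz: "e i \<noteq> 0"
    proof
      assume "e i = 0"
      with inj e0 i have "i = i0" by (auto simp: inj_on_def)
      then show False using zi z X0[OF y] e0 by simp
    qed
    define j where "j = idx i"
    define w where "w = q powr real_of_int j"
    have w: "0 < w" using q by (simp add: w_def)
    have Rj: "R j = q * sqrt (2 * z) * w" by (simp add: R_def w_def)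
    have "(R j / q)\<^sup>2 \<le> (norm (e i))\<^sup>2"
      using idx(2)[OF nz] R[of j] q unfolding j_def by (intro power_mono) auto
    then have "z + (R j / q)\<^sup>2 / 2 \<le> X y i" using zi by simp
    then have "(z + (R j / q)\<^sup>2 / 2) / R j \<le> X y i / R j"
      using R[of j] by (intro divide_right_mono) auto
    also have "(z + (R j / q)\<^sup>2 / 2) / R j = a * ((w + inverse w) / 2)"
    proof -
      define s where "s = sqrt (2 * z)"
      have s: "0 < s" "z = s\<^sup>2 / 2" using z by (auto simp: s_def)
      show ?thesis
        unfolding Rj a_def s_def[symmetric] s(2) using s(1) q w
        by (simp add: field_simps power2_eq_square)
    qed
    finally have Xge: "a * ((w + inverse w) / 2) \<le> X y i / R j" .
    have wq: "w + inverse w = q ^ nat \<bar>j\<bar> + inverse q ^ nat \<bar>j\<bar>"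
    proof (cases "0 \<le> j")
      case True
      then have "w = q ^ nat j" using q by (simp add: w_def powr_real_of_int)
      with True show ?thesis by (simp add: power_inverse)
    next
      case False
      then have "w = inverse (q ^ nat (- j))" using q by (simp add: w_def powr_real_of_int)
      with False show ?thesis by (simp add: power_inverse)
    qed
    have "a * (1 + real (nat \<bar>j\<bar>) * \<kappa>) \<le> a * ((w + inverse w) / 2)"
      unfolding \<kappa>_def wq using a by (intro mult_left_mono reciprocal_power_sum_ge q) auto
    also note Xge
    finally have "a * (1 + real (nat \<bar>j\<bar>) * \<kappa>) \<le> X y i / R j" .
    then show "y \<in> (\<Union>j\<in>J. Ev j)"
      using y i nz by (auto simp: J_def Ev_def Fj_def j_def)
  qed
  have "prob {y \<in> space M. \<exists>i\<in>F. z \<le> X y i - (norm (e i))\<^sup>2 / 2} \<le> prob (\<Union>j\<in>J. Ev j)"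
    using sub by (rule finite_measure_mono) (use Ev_sets fin in \<open>auto simp: J_def\<close>)
  also have "\<dots> \<le> (\<Sum>j\<in>J. prob (Ev j))"
    using Ev_sets fin by (intro finite_measure_subadditive_finite) (auto simp: J_def)
  also have "\<dots> \<le> (\<Sum>j\<in>J. exp (C - \<mu> * a) * r ^ nat \<bar>j\<bar>)"
    by (intro sum_mono Ev_prob)
  also have "\<dots> = exp (C - \<mu> * a) * (\<Sum>j\<in>J. r ^ nat \<bar>j\<bar>)"
    by (simp add: sum_distrib_left)
  also have "\<dots> \<le> exp (C - \<mu> * a) * (2 / (1 - r))"
    using fin r by (intro mult_left_mono sum_geometric_int_le) (auto simp: J_def)
  finally show ?thesis by (simp add: C_def r_def)
qed

section \<open>Arithmetic of the quantile function\<close>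

text \<open>
  A common lower bound for the two branches of z0. In the first branch G and T are both
  1 + sqrt (x + Q), in the second one G is the largest admissible value g0. The slack 49/10 comes
  from 1 + 2 sqrt (x + Q) in the expanded square, together with the difference of the constants 2.7
  and 2 if p = 1; in the second branch it comes from the square of g0, which is at least 9.
\<close>

lemma z0_dominates_product:
  assumes p: "1 \<le> p" and x: "0 < x" and g0: "3 \<le> g0"
  obtains G T where "0 < G" "G \<le> g0" "G \<le> T" "T\<^sup>2 \<le> z0 g0 x (entropy_Q p)"
    "x + 2 * real p + 49 / 10 \<le> G * T"
proof -
  define Q where "Q = entropy_Q p"
  have Q: "2 * real p \<le> Q" "27 / 10 \<le> Q" using p by (auto simp: Q_def entropy_Q_def)
  show ?thesis
  proof (cases "1 + sqrt (x + Q) \<le> g0")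
    case True
    define G where "G = 1 + sqrt (x + Q)"
    have "x + 2 * real p + 49 / 10 \<le> G * G"
    proof -
      have GG: "G * G = 1 + (x + Q) + 2 * sqrt (x + Q)"
        using x Q by (simp add: G_def algebra_simps)
      show ?thesis
      proof (cases "p = 1")
        case True
        then have "Q = 27 / 10" by (simp add: Q_def entropy_Q_def)
        moreover from this have "16 / 10 \<le> sqrt (x + Q)"
          using x by (intro real_le_rsqrt) (simp add: power2_eq_square)
        ultimately show ?thesis using True by (simp add: GG)
      next
        case False
        then have "Q = 2 * real p" "4 \<le> Q" using p by (auto simp: Q_def entropy_Q_def)
        moreover from this have "2 \<le> sqrt (x + Q)"
          using x by (intro real_le_rsqrt) simp
        ultimately show ?thesis by (simp add: GG)
      qed
    qed
    moreover have "0 < G" using x Q by (simp add: G_def add_pos_nonneg)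
    ultimately show ?thesis
      using that[of G G] True by (simp add: z0_def Q_def G_def)
  next
    case False
    define T where "T = 2 * inverse g0 * (x + Q) + g0"
    have "g0 * T = 2 * (x + Q) + g0 * g0" using g0 by (simp add: T_def field_simps)
    moreover have "3 * 3 \<le> g0 * g0" using g0 by (intro mult_mono) auto
    ultimately have "x + 2 * real p + 49 / 10 \<le> g0 * T" using Q x by simp
    moreover have "g0 \<le> T" using g0 x Q by (simp add: T_def)
    ultimately show ?thesis
      using that[of g0 T] False g0 by (simp add: z0_def Q_def T_def)
  qed
qed

text \<open>
  The bound rests on exp 1 \<ge> 5/2 and 2 * 1059 / 59 < (5/2)^4.
\<close>

lemma slicing_prefactor_le:
  fixes t :: real
  assumes "59 / 1000 \<le> t"
  shows "2 / (1 - exp (- t)) \<le> exp 4"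
proof -
  have "1 + 59 / 1000 \<le> exp t"
    using exp_ge_add_one_self[of t] assms by linarith
  then have "inverse (exp t) \<le> inverse (1059 / 1000)"
    by (intro le_imp_inverse_le) auto
  then have *: "59 / 1059 \<le> 1 - exp (- t)" by (simp add: exp_minus)
  have "2 / (1 - exp (- t)) \<le> 2 / (59 / 1059)"
    using * assms by (intro divide_left_mono mult_pos_pos) auto
  also have "\<dots> \<le> (5 / 2 :: real) ^ 4" by (simp add: power4_eq_xxxx)
  also have "\<dots> \<le> exp 1 ^ 4"
    using exp_lower_Taylor_quadratic[of "1::real"] by (intro power_mono) auto
  also have "\<dots> = exp 4"
    using exp_of_nat_mult[of 4 "1::real"] by simp
  finally show ?thesis .
qed

text \<open>
  Here \<mu> is 3 G / 2, the largest value allowed by the range 3 g0 of the exponents when G = g0.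
  Since 1.397^2 < 2 * 0.99 and 1.397 / 1.1 = 1.27, the threshold a is at least 1.27 T, so the
  exponent gains 1.905 G T from the threshold and loses at most G T / 2 to the variance term. The
  difference 1.405 G T exceeds x + 4 p ln 2 + 4, where the last 4 absorbs the geometric series:
  its ratio is exp (- \<mu> a / 220), and \<mu> a is at least 1.905 * 6.9.
\<close>

lemma penalized_tail_numeric:
  fixes g0 x z :: real and p :: nat
  defines "z \<equiv> 99 / 100 * z0 g0 x (entropy_Q p)"
  assumes p: "1 \<le> p" and x: "0 < x" and g0: "3 \<le> g0"
  obtains \<mu> where "0 < \<mu>" "2 * \<mu> \<le> 3 * g0"
    "exp (4 * ln 2 * real p + 2 * (1 / 3)\<^sup>2 * \<mu>\<^sup>2 - \<mu> * (sqrt (2 * z) / (11 / 10)))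
      * (2 / (1 - exp (- \<mu> * (sqrt (2 * z) / (11 / 10)) * ((11 / 10 - 1)\<^sup>2 / (2 * (11 / 10)))))) \<le> exp (- x)"
proof -
  obtain G T where GT: "0 < G" "G \<le> g0" "G \<le> T" "T\<^sup>2 \<le> z0 g0 x (entropy_Q p)"
    "x + 2 * real p + 49 / 10 \<le> G * T"
    by (rule z0_dominates_product[OF p x g0])
  define \<mu> where "\<mu> = 3 / 2 * G"
  define a where "a = sqrt (2 * z) / (11 / 10)"
  have "1397 / 1000 * T \<le> sqrt (2 * z)"
  proof (rule real_le_rsqrt)
    have "(1397 / 1000 * T)\<^sup>2 \<le> 2 * (99 / 100) * T\<^sup>2" by (simp add: power_mult_distrib power2_eq_square)
    also have "\<dots> \<le> 2 * z" using GT(4) by (simp add: z_def)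
    finally show "(1397 / 1000 * T)\<^sup>2 \<le> 2 * z" .
  qed
  then have "127 / 100 * T \<le> a" by (simp add: a_def)
  then have "\<mu> * (127 / 100 * T) \<le> \<mu> * a" using GT(1) by (intro mult_left_mono) (auto simp: \<mu>_def)
  then have \<mu>a: "1905 / 1000 * (G * T) \<le> \<mu> * a" by (simp add: \<mu>_def)
  have "69 / 10 \<le> G * T" using GT(5) p x by simp
  then have "59 / 1000 \<le> \<mu> * a / 220" using \<mu>a by simp
  then have S: "2 / (1 - exp (- (\<mu> * a / 220))) \<le> exp 4" by (rule slicing_prefactor_le)
  have GG: "G * G \<le> G * T" using GT by (intro mult_left_mono) auto
  have sq: "2 * (1 / 3)\<^sup>2 * \<mu>\<^sup>2 = 1 / 2 * (G * G)" by (simp add: \<mu>_def power2_eq_square)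
  have "4 * ln 2 * real p \<le> 25 / 9 * real p"
    using ln2_le_25_over_36 by (intro mult_right_mono) auto
  moreover have "1 \<le> real p" using p by simp
  ultimately have expo: "4 * ln 2 * real p + 2 * (1 / 3)\<^sup>2 * \<mu>\<^sup>2 - \<mu> * a + 4 \<le> - x"
    unfolding sq using GG \<mu>a GT(5) x by linarith
  have "- \<mu> * a * ((11 / 10 - 1)\<^sup>2 / (2 * (11 / 10))) = - (\<mu> * a / 220)"
    by (simp add: power2_eq_square)
  then have "exp (4 * ln 2 * real p + 2 * (1 / 3)\<^sup>2 * \<mu>\<^sup>2 - \<mu> * a)
      * (2 / (1 - exp (- \<mu> * a * ((11 / 10 - 1)\<^sup>2 / (2 * (11 / 10))))))
      \<le> exp (4 * ln 2 * real p + 2 * (1 / 3)\<^sup>2 * \<mu>\<^sup>2 - \<mu> * a) * exp 4"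
    using S by (simp only:) (intro mult_left_mono, auto)
  also have "\<dots> \<le> exp (- x)" using expo by (simp add: mult_exp_exp)
  finally have le: "exp (4 * ln 2 * real p + 2 * (1 / 3)\<^sup>2 * \<mu>\<^sup>2 - \<mu> * a)
      * (2 / (1 - exp (- \<mu> * a * ((11 / 10 - 1)\<^sup>2 / (2 * (11 / 10)))))) \<le> exp (- x)" .
  have "0 < \<mu>" "2 * \<mu> \<le> 3 * g0" using GT by (simp_all add: \<mu>_def)
  then show ?thesis using le unfolding a_def by (rule that)
qed

section \<open>Countable index sets\<close>

text \<open>
  Continuity of the measure along an enumeration of the index set.
\<close>

lemma (in finite_measure) measure_UN_le_of_finite_subsets:
  assumes D: "countable D" and E: "\<And>i. i \<in> D \<Longrightarrow> E i \<in> sets M"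
    and le: "\<And>F. finite F \<Longrightarrow> F \<subseteq> D \<Longrightarrow> measure M (\<Union>i\<in>F. E i) \<le> c"
  shows "measure M (\<Union>i\<in>D. E i) \<le> c"
proof (cases "D = {}")
  case True
  then show ?thesis using le[of "{}"] by simp
next
  case False
  define A where "A n = (\<Union>i\<in>from_nat_into D ` {..n}. E i)" for n
  have D': "from_nat_into D n \<in> D" for n using False by (rule from_nat_into)
  have inc: "incseq A"
    unfolding incseq_def A_def by (intro allI impI UN_mono image_mono) auto
  have AM: "range A \<subseteq> sets M"
    using E D' by (auto simp: A_def)
  have lim: "(\<lambda>n. measure M (A n)) \<longlonglongrightarrow> measure M (\<Union>n. A n)"
    using AM inc by (rule finite_Lim_measure_incseq)
  have "(\<Union>n. A n) = (\<Union>i\<in>range (from_nat_into D). E i)" by (auto simp: A_def)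
  then have UN: "(\<Union>n. A n) = (\<Union>i\<in>D. E i)"
    using range_from_nat_into[OF False D] by simp
  have "measure M (A n) \<le> c" for n
    unfolding A_def using D' by (intro le) auto
  with lim show ?thesis
    unfolding UN by (intro LIMSEQ_le_const2) auto
qed

lemma penalized_tail_countable:
  fixes e :: "'i \<Rightarrow> 'a::euclidean_space"
  assumes inc: "subexp_increments M e (1 / 3) (3 * g0) (insert i0 D) X"
    and prob: "prob_space M" and D: "countable D" and inj: "inj_on e (insert i0 D)"
    and e0: "e i0 = 0" and X0: "\<And>y. y \<in> space M \<Longrightarrow> X y i0 = 0"
    and g0: "3 \<le> g0" and x: "0 < x"
  shows "measure M {y \<in> space M. \<exists>i\<in>D. 99 / 100 * z0 g0 x (entropy_Q DIM('a)) \<le> X y i - (norm (e i))\<^sup>2 / 2}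
    \<le> exp (- x)"
proof -
  interpret prob_space M by fact
  define z where "z = 99 / 100 * z0 g0 x (entropy_Q DIM('a))"
  have z: "0 < z"
  proof -
    obtain G T where "0 < G" "G \<le> T" "T\<^sup>2 \<le> z0 g0 x (entropy_Q DIM('a))"
      using z0_dominates_product[OF _ x g0, of "DIM('a)"] by (metis DIM_positive Suc_leI One_nat_def)
    moreover from this have "0 < T\<^sup>2" by simp
    ultimately show ?thesis unfolding z_def by linarith
  qed
  obtain \<mu> where \<mu>: "0 < \<mu>" "2 * \<mu> \<le> 3 * g0" and num:
    "exp (4 * ln 2 * real DIM('a) + 2 * (1 / 3)\<^sup>2 * \<mu>\<^sup>2 - \<mu> * (sqrt (2 * z) / (11 / 10)))
      * (2 / (1 - exp (- \<mu> * (sqrt (2 * z) / (11 / 10)) * ((11 / 10 - 1)\<^sup>2 / (2 * (11 / 10)))))) \<le> exp (- x)"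
    unfolding z_def by (rule penalized_tail_numeric[OF _ x g0, of "DIM('a)"]) (auto simp: Suc_le_eq)
  define E where "E i = {y \<in> space M. z \<le> X y i - (norm (e i))\<^sup>2 / 2}" for i
  have UN: "{y \<in> space M. \<exists>i\<in>F. z \<le> X y i - (norm (e i))\<^sup>2 / 2} = (\<Union>i\<in>F. E i)" for F
    by (auto simp: E_def)
  have "prob (\<Union>i\<in>D. E i) \<le> exp (- x)"
  proof (rule measure_UN_le_of_finite_subsets[OF D])
    fix i assume "i \<in> D"
    then have [measurable]: "(\<lambda>y. X y i) \<in> borel_measurable M"
      by (intro subexp_incrementsD(1)[OF inc]) auto
    show "E i \<in> sets M" unfolding E_def by measurable
  next
    fix F assume F: "finite F" "F \<subseteq> D"
    then have sub: "insert i0 F \<subseteq> insert i0 D" by auto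
    have "subexp_increments M e (1 / 3) (3 * g0) (insert i0 F) X"
      using inc sub unfolding subexp_increments_def by blast
    from penalized_tail_finite[OF this prob F(1) inj_on_subset[OF inj sub] e0 X0 \<mu> z, of "11 / 10"] num
    show "prob (\<Union>i\<in>F. E i) \<le> exp (- x)"
      unfolding UN by simp
  qed
  then show ?thesis by (simp add: UN[symmetric] z_def)
qed

section \<open>Gradients and the linearisation remainder\<close>

lemma GDERIV_unique:
  assumes "GDERIV f x :> D" "GDERIV f x :> D'"
  shows "D = D'"
proof -
  have "(\<lambda>h. h \<bullet> D) = (\<lambda>h. h \<bullet> D')"
    using assms unfolding gderiv_def by (rule has_derivative_unique)
  then have "(D - D') \<bullet> D = (D - D') \<bullet> D'" by metis
  then have "(D - D') \<bullet> (D - D') = 0" by (simp add: inner_diff_right)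
  then show ?thesis by simp
qed

lemma grad_eqI: "GDERIV f x :> D \<Longrightarrow> grad f x = D"
  unfolding grad_def by (blast intro: GDERIV_unique)

lemma GDERIV_grad:
  fixes f :: "'a::euclidean_space \<Rightarrow> real"
  assumes "f differentiable (at x)"
  shows "GDERIV f x :> grad f x"
proof -
  obtain D where D: "(f has_derivative D) (at x)"
    using assms by (auto simp: differentiable_def)
  then have lin: "linear D" by (rule has_derivative_linear)
  have "D h = h \<bullet> (\<Sum>b\<in>Basis. D b *\<^sub>R b)" for h
  proof -
    have "D h = D (\<Sum>b\<in>Basis. (h \<bullet> b) *\<^sub>R b)" by (simp add: euclidean_representation)
    also have "\<dots> = (\<Sum>b\<in>Basis. (h \<bullet> b) * D b)"
      by (simp add: linear_sum[OF lin] linear_cmul[OF lin])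
    finally show ?thesis by (simp add: inner_sum_right mult.commute)
  qed
  then have "D = (\<lambda>h. h \<bullet> (\<Sum>b\<in>Basis. D b *\<^sub>R b))" by blast
  with D have "GDERIV f x :> (\<Sum>b\<in>Basis. D b *\<^sub>R b)" by (simp add: gderiv_def)
  then show ?thesis using grad_eqI by metis
qed

lemma has_real_derivative_along_segment:
  assumes "GDERIV f (a + t *\<^sub>R h) :> G"
  shows "((\<lambda>t. f (a + t *\<^sub>R h)) has_real_derivative (h \<bullet> G)) (at t within T)"
proof -
  have "((\<lambda>t. a + t *\<^sub>R h) has_derivative (\<lambda>s. s *\<^sub>R h)) (at t within T)"
    by (auto intro!: derivative_eq_intros)
  from has_derivative_compose[OF this assms[unfolded gderiv_def]]
  have "((\<lambda>t. f (a + t *\<^sub>R h)) has_derivative (\<lambda>s. (s *\<^sub>R h) \<bullet> G)) (at t within T)"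
 .
  moreover have "(\<lambda>s. (s *\<^sub>R h) \<bullet> G) = (*) (h \<bullet> G)" by (simp add: fun_eq_iff)
  ultimately show ?thesis by (simp add: has_field_derivative_def)
qed

definition lin_remainder :: "('a::real_inner \<Rightarrow> real) \<Rightarrow> 'a \<Rightarrow> 'a \<Rightarrow> real" where
  "lin_remainder f a x = (f x - f a) - (x - a) \<bullet> grad f a"

text \<open>
  Only the values of f on S are known to be measurable. The linear term is nevertheless measurable
  at points of S, since it is a limit of difference quotients along the segment from a to x, and
  convexity keeps this segment in S.
\<close>

lemma borel_measurable_lin_remainder:
  fixes f :: "'y \<Rightarrow> 'a::euclidean_space \<Rightarrow> real"
  assumes S: "convex S" "a \<in> S" "x \<in> S"
    and meas: "\<And>x. x \<in> S \<Longrightarrow> (\<lambda>y. f y x) \<in> borel_measurable M"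
    and diff: "\<And>y. y \<in> space M \<Longrightarrow> f y differentiable (at a)"
  shows "(\<lambda>y. lin_remainder (f y) a x) \<in> borel_measurable M"
proof -
  have "(\<lambda>y. (x - a) \<bullet> grad (f y) a) \<in> borel_measurable M"
  proof (rule borel_measurable_LIMSEQ_real)
    fix n
    have "(1 - 1 / real (Suc n)) *\<^sub>R a + (1 / real (Suc n)) *\<^sub>R x \<in> S"
      using S by (intro convexD) auto
    then have "a + (1 / real (Suc n)) *\<^sub>R (x - a) \<in> S" by (simp add: algebra_simps)
    then show "(\<lambda>y. (f y (a + (1 / real (Suc n)) *\<^sub>R (x - a)) - f y a) / (1 / real (Suc n))) \<in> borel_measurable M"
      using S by (intro borel_measurable_divide borel_measurable_diff meas borel_measurable_const)
  next
    fix y assume y: "y \<in> space M"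
    have "GDERIV (f y) (a + 0 *\<^sub>R (x - a)) :> grad (f y) a"
      using GDERIV_grad[OF diff[OF y]] by simp
    from has_real_derivative_along_segment[OF this, of UNIV]
    have "((\<lambda>t. (f y (a + t *\<^sub>R (x - a)) - f y a) / t) \<longlongrightarrow> (x - a) \<bullet> grad (f y) a) (at 0)"
      by (simp add: has_field_derivative_iff)
    moreover have "filterlim (\<lambda>n. 1 / real (Suc n)) (at 0) sequentially"
      unfolding filterlim_at using lim_1_over_n[THEN LIMSEQ_Suc] by (auto simp: eventually_sequentially)
    ultimately show "(\<lambda>n. (f y (a + (1 / real (Suc n)) *\<^sub>R (x - a)) - f y a) / (1 / real (Suc n)))
        \<longlonglongrightarrow> (x - a) \<bullet> grad (f y) a"
      by (rule filterlim_compose)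
  qed
  then show ?thesis
    unfolding lin_remainder_def using S
    by (intro borel_measurable_diff meas)
qed

lemma nn_integral_exp_le:
  assumes "log_exp_moment P X \<le> ereal k"
  shows "(\<integral>\<^sup>+y. ennreal (exp (X y)) \<partial>P) \<le> ennreal (exp k)"
proof -
  have int: "integrable P (\<lambda>y. exp (X y))" and k: "ln (\<integral>y. exp (X y) \<partial>P) \<le> k"
    using assms by (auto simp: log_exp_moment_def split: if_splits)
  have "(\<integral>y. exp (X y) \<partial>P) \<le> exp k"
  proof (cases "0 < (\<integral>y. exp (X y) \<partial>P)")
    case True
    with k show ?thesis by (metis exp_le_cancel_iff exp_ln)
  next
    case False
    then show ?thesis using exp_ge_zero[of k] by linarith
  qed
  then show ?thesis
    using int by (subst nn_integral_eq_integral) (auto intro: ennreal_leI)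
qed

lemma norm_sym_root_pos:
  assumes "sym_pd A" "x \<noteq> 0"
  shows "0 < norm (sym_root A *v x)"
proof -
  have "0 < x \<bullet> (A *v x)" using assms by (simp add: sym_pd_def)
  then have "0 < (norm (sym_root A *v x))\<^sup>2"
    using norm_sym_root_sq[OF sym_pd_imp_psd[OF assms(1)]] by simp
  then show ?thesis by (simp add: zero_less_power2)
qed

text \<open>
  The directional derivative of the remainder in the direction h = \<theta> - \<theta>' is the inner product
  of h with the increment of the gradient, to which the moment condition applies with the direction
  h. The exponent s corresponds to u = s \<omega> n / \<rho> up to sign, where n is the distance
  of the two points, and \<rho> \<ge> 3 \<nu>0 \<omega> turns the range g into 3 g \<nu>0 and the variance
  factor \<nu>0 into 1/3. For \<omega> = 0 the derivative vanishes almost surely at each point of the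
  segment and the bound is trivial.
\<close>

lemma subexp_increments_lin_remainder:
  fixes \<zeta> :: "'y \<Rightarrow> real^'p \<Rightarrow> real"
  assumes prob: "prob_space P" and S: "convex S" "\<theta>s \<in> S"
    and meas: "\<And>\<theta>. \<theta> \<in> S \<Longrightarrow> (\<lambda>y. \<zeta> y \<theta>) \<in> borel_measurable P"
    and diff: "\<And>y \<theta>. y \<in> space P \<Longrightarrow> \<theta> \<in> S \<Longrightarrow> \<zeta> y differentiable (at \<theta>)"
    and cond: "gradient_moment_cond P \<zeta> S \<theta>s V0sq g \<nu>0 \<omega>"
    and V: "sym_pd V0sq" and pos: "0 < g" "1 \<le> \<nu>0" "0 \<le> \<omega>" "0 < \<rho>" "3 * \<nu>0 * \<omega> \<le> \<rho>"
    and c: "\<bar>c\<bar> = 1"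
  shows "subexp_increments P (\<lambda>\<theta>. sym_root V0sq *v (\<theta> - \<theta>s)) (1 / 3) (3 * (g * \<nu>0)) S
    (\<lambda>y \<theta>. c * lin_remainder (\<zeta> y) \<theta>s \<theta> / \<rho>)"
  unfolding subexp_increments_def
proof (intro conjI ballI allI impI)
  interpret prob_space P by fact
  have lin_meas: "(\<lambda>y. lin_remainder (\<zeta> y) \<theta>s \<theta>) \<in> borel_measurable P" if "\<theta> \<in> S" for \<theta>
    using S that meas diff by (intro borel_measurable_lin_remainder[where S = S]) auto
  show "(\<lambda>y. c * lin_remainder (\<zeta> y) \<theta>s \<theta> / \<rho>) \<in> borel_measurable P" if "\<theta> \<in> S" for \<theta>
    using lin_meas[OF that] by simp
  fix \<theta> \<theta>' s assume \<theta>: "\<theta> \<in> S" "\<theta>' \<in> S"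
    and le: "\<bar>s\<bar> * norm (sym_root V0sq *v (\<theta> - \<theta>s) - sym_root V0sq *v (\<theta>' - \<theta>s)) \<le> 3 * (g * \<nu>0)"
  define h where "h = \<theta> - \<theta>'"
  define n where "n = norm (sym_root V0sq *v h)"
  have n: "norm (sym_root V0sq *v (\<theta> - \<theta>s) - sym_root V0sq *v (\<theta>' - \<theta>s)) = n"
    by (simp add: n_def h_def matrix_vector_mult_diff_distrib)
  show "(\<integral>\<^sup>+y. ennreal (exp (s * (c * lin_remainder (\<zeta> y) \<theta>s \<theta> / \<rho> - c * lin_remainder (\<zeta> y) \<theta>s \<theta>' / \<rho>))) \<partial>P)
      \<le> ennreal (exp ((1 / 3)\<^sup>2 * (s * norm (sym_root V0sq *v (\<theta> - \<theta>s) - sym_root V0sq *v (\<theta>' - \<theta>s)))\<^sup>2 / 2))"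
    unfolding n
  proof (cases "h = 0")
    case True
    then have "\<theta> = \<theta>'" by (simp add: h_def)
    then show "(\<integral>\<^sup>+y. ennreal (exp (s * (c * lin_remainder (\<zeta> y) \<theta>s \<theta> / \<rho> - c * lin_remainder (\<zeta> y) \<theta>s \<theta>' / \<rho>))) \<partial>P)
        \<le> ennreal (exp ((1 / 3)\<^sup>2 * (s * n)\<^sup>2 / 2))"
      by (simp add: emeasure_space_1)
  next
    case False
    then have npos: "0 < n" unfolding n_def by (rule norm_sym_root_pos[OF V])
    define \<gamma> where "\<gamma> t = \<theta>' + t *\<^sub>R h" for t
    have \<gamma>: "\<gamma> t \<in> S" if "t \<in> {0..1}" for t
    proof -
      have "(1 - t) *\<^sub>R \<theta>' + t *\<^sub>R \<theta> \<in> S" using S \<theta> that by (intro convexD) auto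
      then show ?thesis by (simp add: \<gamma>_def h_def algebra_simps)
    qed
    define f where "f y t = s * c / \<rho> * lin_remainder (\<zeta> y) \<theta>s (\<gamma> t)" for y t
    define d where "d y t = s * c / \<rho> * (h \<bullet> (grad (\<zeta> y) (\<gamma> t) - grad (\<zeta> y) \<theta>s))" for y t
    define C where "C = exp ((1 / 3)\<^sup>2 * (s * n)\<^sup>2 / 2)"
    have C1: "1 \<le> C" by (simp add: C_def)
    have bound: "(\<integral>\<^sup>+y. ennreal (exp (\<epsilon> * d y t)) \<partial>P) \<le> ennreal C"
      if t: "t \<in> {0..1}" and \<epsilon>: "\<bar>\<epsilon>\<bar> = 1" for \<epsilon> t
    proof (cases "\<omega> = 0")
      case True
      then have "AE y in P. grad (\<zeta> y) (\<gamma> t) = grad (\<zeta> y) \<theta>s"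
        using cond \<gamma>[OF t] by (simp add: gradient_moment_cond_def)
      then have "(\<integral>\<^sup>+y. ennreal (exp (\<epsilon> * d y t)) \<partial>P) = (\<integral>\<^sup>+y. 1 \<partial>P)"
        by (intro nn_integral_cong_AE) (auto simp: d_def)
      then show ?thesis using C1 by (simp add: emeasure_space_1)
    next
      case False
      then have \<omega>: "0 < \<omega>" using pos by simp
      define u where "u = \<epsilon> * (s * c / \<rho>) * (\<omega> * n)"
      have absu: "\<bar>u\<bar> = \<bar>s\<bar> * n * \<omega> / \<rho>"
        using \<epsilon> c pos npos by (simp add: u_def abs_mult abs_divide)
      have ug: "\<bar>u\<bar> \<le> g"
      proof -
        have "\<bar>s\<bar> * n * \<omega> \<le> 3 * (g * \<nu>0) * \<omega>"
          using le \<omega> unfolding n by (intro mult_right_mono) auto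
        also have "\<dots> = g * (3 * \<nu>0 * \<omega>)" by simp
        also have "\<dots> \<le> g * \<rho>" using pos by (intro mult_left_mono) auto
        finally show ?thesis unfolding absu using pos by (simp add: divide_le_eq)
      qed
      have "(SUP \<gamma>'\<in>UNIV - {0}. log_exp_moment P (\<lambda>y.
            u * ((\<gamma>' \<bullet> (grad (\<zeta> y) (\<gamma> t) - grad (\<zeta> y) \<theta>s)) / (\<omega> * norm (sym_root V0sq *v \<gamma>')))))
          \<le> ereal (\<nu>0\<^sup>2 * u\<^sup>2 / 2)"
        using cond \<gamma>[OF t] ug False by (simp add: gradient_moment_cond_def)
      then have "log_exp_moment P (\<lambda>y.
            u * ((h \<bullet> (grad (\<zeta> y) (\<gamma> t) - grad (\<zeta> y) \<theta>s)) / (\<omega> * norm (sym_root V0sq *v h))))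
          \<le> ereal (\<nu>0\<^sup>2 * u\<^sup>2 / 2)"
        using \<open>h \<noteq> 0\<close> unfolding SUP_le_iff by blast
      also have "(\<lambda>y. u * ((h \<bullet> (grad (\<zeta> y) (\<gamma> t) - grad (\<zeta> y) \<theta>s)) / (\<omega> * norm (sym_root V0sq *v h))))
          = (\<lambda>y. \<epsilon> * d y t)"
        using \<omega> npos by (simp add: u_def d_def n_def fun_eq_iff)
      finally have "(\<integral>\<^sup>+y. ennreal (exp (\<epsilon> * d y t)) \<partial>P) \<le> ennreal (exp (\<nu>0\<^sup>2 * u\<^sup>2 / 2))"
        by (rule nn_integral_exp_le)
      also have "\<dots> \<le> ennreal C"
      proof -
        have "\<nu>0 * \<bar>u\<bar> = \<bar>s * n\<bar> * (\<nu>0 * \<omega>) / \<rho>"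
          unfolding absu using npos by (simp add: abs_mult)
        also have "\<dots> \<le> \<bar>s * n\<bar> * (\<rho> / 3) / \<rho>"
          using pos by (intro divide_right_mono mult_left_mono) auto
        also have "\<dots> = \<bar>s * n\<bar> / 3" using pos by simp
        finally have "(\<nu>0 * \<bar>u\<bar>)\<^sup>2 \<le> (\<bar>s * n\<bar> / 3)\<^sup>2"
          using pos by (intro power_mono) auto
        then have "\<nu>0\<^sup>2 * u\<^sup>2 \<le> (s * n)\<^sup>2 / 9"
          by (simp only: power_mult_distrib power_divide power2_abs) simp
        then show ?thesis
          unfolding C_def by (intro ennreal_leI) (simp add: power2_eq_square)
      qed
      finally show ?thesis .
    qed
    have "(\<integral>\<^sup>+y. ennreal (exp (f y 1 - f y 0)) \<partial>P) \<le> ennreal C"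
    proof (rule exp_moment_increment_le_derivative[OF prob, where d = d])
      show "(\<lambda>y. f y t) \<in> borel_measurable P" if "t \<in> {0..1}" for t
        unfolding f_def using lin_meas[OF \<gamma>[OF that]] by simp
      show "(f y has_real_derivative d y t) (at t within {0..1})" if y: "y \<in> space P" and t: "t \<in> {0..1}" for y t
      proof -
        have "GDERIV (\<zeta> y) (\<gamma> t) :> grad (\<zeta> y) (\<gamma> t)"
          by (rule GDERIV_grad[OF diff[OF y \<gamma>[OF t]]])
        from has_real_derivative_along_segment[OF this[unfolded \<gamma>_def]]
        have *: "((\<lambda>t. \<zeta> y (\<gamma> t)) has_real_derivative h \<bullet> grad (\<zeta> y) (\<gamma> t)) (at t within {0..1})"
          unfolding \<gamma>_def .
        have "((\<lambda>t. (\<gamma> t - \<theta>s) \<bullet> grad (\<zeta> y) \<theta>s) has_real_derivative h \<bullet> grad (\<zeta> y) \<theta>s) (at t within {0..1})"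
          unfolding \<gamma>_def inner_diff_left inner_add_left inner_scaleR_left
          by (auto intro!: derivative_eq_intros)
        note DERIV_cmult[OF DERIV_diff[OF DERIV_diff[OF * DERIV_const] this], of "s * c / \<rho>" "\<zeta> y \<theta>s"]
        then show ?thesis
          unfolding f_def d_def lin_remainder_def by (simp add: inner_diff_right)
      qed
      show "(\<integral>\<^sup>+y. ennreal (exp (d y t)) \<partial>P) \<le> ennreal C" if "t \<in> {0..1}" for t
        using bound[OF that, of 1] by simp
      show "(\<integral>\<^sup>+y. ennreal (exp (- d y t)) \<partial>P) \<le> ennreal C" if "t \<in> {0..1}" for t
        using bound[OF that, of "-1"] by simp
    qed
    then show "(\<integral>\<^sup>+y. ennreal (exp (s * (c * lin_remainder (\<zeta> y) \<theta>s \<theta> / \<rho> - c * lin_remainder (\<zeta> y) \<theta>s \<theta>' / \<rho>))) \<partial>P)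
        \<le> ennreal (exp ((1 / 3)\<^sup>2 * (s * n)\<^sup>2 / 2))"
      by (simp add: f_def \<gamma>_def h_def C_def right_diff_distrib mult.assoc)
  qed
qed

section \<open>The error terms as separable suprema\<close>

lemma SUP_dense_eq:
  fixes f :: "'a::metric_space \<Rightarrow> real"
  assumes cont: "continuous_on S f" and D: "D \<subseteq> S" "S \<subseteq> closure D"
  shows "(SUP x\<in>S. ereal (f x)) = (SUP x\<in>D. ereal (f x))"
proof (rule antisym)
  show "(SUP x\<in>S. ereal (f x)) \<le> (SUP x\<in>D. ereal (f x))"
  proof (rule SUP_least)
    fix x assume x: "x \<in> S"
    then have "x \<in> closure D" using D(2) by blast
    then obtain d where d: "\<And>n. d n \<in> D" "d \<longlonglongrightarrow> x"
      unfolding closure_sequential by blast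
    have "(\<lambda>n. f (d n)) \<longlonglongrightarrow> f x"
      using d D x by (intro continuous_on_tendsto_compose[OF cont]) (auto simp: subset_iff)
    then have "(\<lambda>n. ereal (f (d n))) \<longlonglongrightarrow> ereal (f x)" by simp
    then show "ereal (f x) \<le> (SUP x\<in>D. ereal (f x))"
      by (rule LIMSEQ_le_const2) (meson SUP_upper d(1))
  qed
  show "(SUP x\<in>D. ereal (f x)) \<le> (SUP x\<in>S. ereal (f x))"
    using D(1) by (intro SUP_subset_mono) auto
qed

text \<open>
  The sign c gives the two error terms. Paths are continuous on S, so the supremum may be taken
  over a countable dense subset; this yields measurability. A supremum of at least z is in general
  only approached, and the event is therefore compared with the event that some point of the dense
  subset reaches 99/100 of z, which includes the former as z is positive.
\<close>

lemma penalized_remainder_sup: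
  fixes \<zeta> :: "'y \<Rightarrow> real^'p \<Rightarrow> real" and S :: "(real^'p) set" and \<theta>s :: "real^'p"
    and V0sq :: "real^'p^'p" and c \<rho> :: real
  defines "err \<equiv> \<lambda>y. SUP \<theta>\<in>S. ereal (c * lin_remainder (\<zeta> y) \<theta>s \<theta>
      - \<rho> / 2 * (norm (sym_root V0sq *v (\<theta> - \<theta>s)))\<^sup>2)"
  assumes prob: "prob_space P" and S: "convex S" "S \<noteq> {} \<longrightarrow> \<theta>s \<in> S"
    and meas: "\<forall>\<theta>\<in>S. (\<lambda>y. \<zeta> y \<theta>) \<in> borel_measurable P"
    and diff: "\<forall>y\<in>space P. \<forall>\<theta>\<in>S. \<zeta> y differentiable (at \<theta>)"
    and cond: "gradient_moment_cond P \<zeta> S \<theta>s V0sq g \<nu>0 \<omega>"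
    and V: "sym_pd V0sq" and pos: "0 < g" "1 \<le> \<nu>0" "0 \<le> \<omega>" "0 < \<rho>" "3 * \<nu>0 * \<omega> \<le> \<rho>"
    and c: "\<bar>c\<bar> = 1" and g0: "3 \<le> g * \<nu>0"
  shows "err \<in> borel_measurable P"
    and "0 < x \<Longrightarrow> measure P {y\<in>space P. ereal (inverse \<rho>) * err y
        \<ge> ereal (z0 (g * \<nu>0) x (entropy_Q CARD('p)))} \<le> exp (- x)"
proof -
  interpret prob_space P by fact
  define N where "N \<theta> = norm (sym_root V0sq *v (\<theta> - \<theta>s))" for \<theta>
  define A where "A y \<theta> = c * lin_remainder (\<zeta> y) \<theta>s \<theta> - \<rho> / 2 * (N \<theta>)\<^sup>2" for y \<theta>
  obtain D where D: "countable D" "D \<subseteq> S" "S \<subseteq> closure D"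
    using separable[of S] by metis
  have err: "err y = (SUP \<theta>\<in>D. ereal (A y \<theta>))" if y: "y \<in> space P" for y
  proof -
    have "continuous_on S (\<zeta> y)"
      using diff y by (intro continuous_at_imp_continuous_on ballI differentiable_imp_continuous_within) auto
    moreover have "continuous_on S (\<lambda>\<theta>. sym_root V0sq *v (\<theta> - \<theta>s))"
      by (rule continuous_on_compose2[OF matrix_vector_mult_linear_continuous_on[of UNIV]])
        (auto intro!: continuous_intros)
    ultimately have "continuous_on S (A y)"
      unfolding A_def lin_remainder_def N_def by (intro continuous_intros)
    then show ?thesis
      unfolding err_def A_def N_def using D by (intro SUP_dense_eq) auto
  qed
  have A_meas: "(\<lambda>y. A y \<theta>) \<in> borel_measurable P" if "\<theta> \<in> S" for \<theta>
  proof -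
    have "(\<lambda>y. lin_remainder (\<zeta> y) \<theta>s \<theta>) \<in> borel_measurable P"
      using S that meas diff by (intro borel_measurable_lin_remainder[where S = S]) auto
    then show ?thesis unfolding A_def by simp
  qed
  have "(\<lambda>y. SUP \<theta>\<in>D. ereal (A y \<theta>)) \<in> borel_measurable P"
    using D A_meas by (intro borel_measurable_SUP borel_measurable_ereal) auto
  then show "err \<in> borel_measurable P"
    using err by (subst measurable_cong[where g = "\<lambda>y. SUP \<theta>\<in>D. ereal (A y \<theta>)"]) auto
  assume x: "0 < x"
  define z where "z = z0 (g * \<nu>0) x (entropy_Q CARD('p))"
  show "measure P {y\<in>space P. ereal (inverse \<rho>) * err y \<ge> ereal (z0 (g * \<nu>0) x (entropy_Q CARD('p)))} \<le> exp (- x)"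
    unfolding z_def[symmetric]
  proof (cases "S = {}")
    case True
    then have "err y = - \<infinity>" for y by (simp add: err_def bot_ereal_def)
    then have "{y\<in>space P. ereal (inverse \<rho>) * err y \<ge> ereal z} = {}" using pos by auto
    then show "measure P {y\<in>space P. ereal (inverse \<rho>) * err y \<ge> ereal z} \<le> exp (- x)"
      by (simp only: measure_empty exp_ge_zero)
  next
    case False
    then have \<theta>s: "\<theta>s \<in> S" using S by blast
    define X where "X y \<theta> = c * lin_remainder (\<zeta> y) \<theta>s \<theta> / \<rho>" for y \<theta>
    define e where "e \<theta> = sym_root V0sq *v (\<theta> - \<theta>s)" for \<theta>
    have "subexp_increments P e (1 / 3) (3 * (g * \<nu>0)) S X"
      unfolding e_def X_def
      using meas diff by (intro subexp_increments_lin_remainder[OF prob S(1) \<theta>s _ _ cond V pos c]) auto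
    then have inc: "subexp_increments P e (1 / 3) (3 * (g * \<nu>0)) (insert \<theta>s D) X"
      using D(2) \<theta>s unfolding subexp_increments_def by blast
    have inj: "inj_on e T" for T
    proof (rule inj_onI, rule ccontr)
      fix u v assume "e u = e v" "u \<noteq> v"
      then have "sym_root V0sq *v (u - v) = 0"
        by (simp add: e_def matrix_vector_mult_diff_distrib)
      then show False using norm_sym_root_pos[OF V, of "u - v"] \<open>u \<noteq> v\<close> by simp
    qed
    define Ev where "Ev = {y \<in> space P. \<exists>\<theta>\<in>D. 99 / 100 * z \<le> X y \<theta> - (norm (e \<theta>))\<^sup>2 / 2}"
    have tail: "measure P Ev \<le> exp (- x)"
      using penalized_tail_countable[OF inc prob D(1) inj _ _ g0 x]
      by (simp add: Ev_def z_def e_def X_def lin_remainder_def)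
    have AX: "A y \<theta> = \<rho> * (X y \<theta> - (norm (e \<theta>))\<^sup>2 / 2)" for y \<theta>
      using pos by (simp add: A_def X_def e_def N_def right_diff_distrib)
    have z: "0 < z"
    proof -
      obtain G T where "0 < G" "G \<le> T" "T\<^sup>2 \<le> z"
        unfolding z_def by (rule z0_dominates_product[OF _ x g0, of "CARD('p)"]) (auto simp: Suc_le_eq)
      moreover from this have "0 < T\<^sup>2" by simp
      ultimately show ?thesis by linarith
    qed
    have "{y\<in>space P. ereal (inverse \<rho>) * err y \<ge> ereal z} \<subseteq> Ev"
    proof (rule subsetI, rule ccontr)
      fix y assume "y \<in> {y\<in>space P. ereal (inverse \<rho>) * err y \<ge> ereal z}" and n: "y \<notin> Ev"
      then have y: "y \<in> space P" and ge: "ereal z \<le> ereal (inverse \<rho>) * err y" by auto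
      have "err y \<le> ereal (\<rho> * (99 / 100 * z))"
        unfolding err[OF y] AX
      proof (rule SUP_least)
        fix \<theta> assume "\<theta> \<in> D"
        then have "X y \<theta> - (norm (e \<theta>))\<^sup>2 / 2 \<le> 99 / 100 * z"
          using n y by (force simp: Ev_def)
        then show "ereal (\<rho> * (X y \<theta> - (norm (e \<theta>))\<^sup>2 / 2)) \<le> ereal (\<rho> * (99 / 100 * z))"
          using pos by (simp add: mult_left_mono)
      qed
      then have "ereal (inverse \<rho>) * err y \<le> ereal (inverse \<rho>) * ereal (\<rho> * (99 / 100 * z))"
        using pos by (intro ereal_mult_left_mono) auto
      also have "\<dots> = ereal (99 / 100 * z)" using pos by simp
      finally have "ereal z \<le> ereal (99 / 100 * z)" using ge by (rule order_trans[rotated])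
      then show False using z by simp
    qed
    moreover have "Ev \<in> sets P"
    proof -
      have "Ev = (\<Union>\<theta>\<in>D. {y \<in> space P. \<rho> * (99 / 100 * z) \<le> A y \<theta>})"
        using pos by (auto simp: Ev_def AX)
      then show ?thesis
        using D A_meas by (auto intro!: sets.countable_UN'' borel_measurable_le)
    qed
    ultimately have "measure P {y\<in>space P. ereal (inverse \<rho>) * err y \<ge> ereal z} \<le> measure P Ev"
      by (rule finite_measure_mono)
    then show "measure P {y\<in>space P. ereal (inverse \<rho>) * err y \<ge> ereal z} \<le> exp (- x)"
      using tail by linarith
  qed
qed

section \<open>Bracketing of the likelihood ratio\<close>

text \<open>
  All norms of root matrices are quadratic forms in the squared matrices, so that everything
  reduces to linear inequalities between the mean increment m and the forms D and V.
\<close>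

lemma quad_form_bracketing:
  fixes L :: "'y \<Rightarrow> real^'p \<Rightarrow> real"
  assumes int: "integrable P (\<lambda>y. L y \<theta>)" "integrable P (\<lambda>y. L y \<theta>s)"
    and grad: "grad (L y) \<theta>s = grad (stoch P L y) \<theta>s"
    and psd: "sym_pd V0sq" "sym_pd D0sq" "sym_psd (D_eps_sq D0sq V0sq \<delta> \<rho>)"
    and \<delta>: "\<theta> \<noteq> \<theta>s \<Longrightarrow>
      \<bar>(- 2 * (\<integral>y. L y \<theta> - L y \<theta>s \<partial>P)) / (norm (sym_root D0sq *v (\<theta> - \<theta>s)))\<^sup>2 - 1\<bar> \<le> \<delta>"
    and pos: "0 \<le> \<delta>" "0 \<le> \<rho>"
  shows "quad_L L (D_eps_sq D0sq V0sq (-\<delta>) (-\<rho>)) y \<theta> \<theta>s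
      - (- lin_remainder (stoch P L y) \<theta>s \<theta> - \<rho> / 2 * (norm (sym_root V0sq *v (\<theta> - \<theta>s)))\<^sup>2) \<le> L y \<theta> - L y \<theta>s"
    and "L y \<theta> - L y \<theta>s \<le> quad_L L (D_eps_sq D0sq V0sq \<delta> \<rho>) y \<theta> \<theta>s
      + (lin_remainder (stoch P L y) \<theta>s \<theta> - \<rho> / 2 * (norm (sym_root V0sq *v (\<theta> - \<theta>s)))\<^sup>2)"
proof -
  define h where "h = \<theta> - \<theta>s"
  define V where "V = h \<bullet> (V0sq *v h)"
  define D where "D = h \<bullet> (D0sq *v h)"
  have V: "(norm (sym_root V0sq *v h))\<^sup>2 = V" and D: "(norm (sym_root D0sq *v h))\<^sup>2 = D"
    using psd by (simp_all add: V_def D_def norm_sym_root_sq sym_pd_imp_psd)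
  have V0: "0 \<le> V" and D0: "0 \<le> D" using V[symmetric] D[symmetric] by simp_all
  have eps: "h \<bullet> (D_eps_sq D0sq V0sq d r *v h) = (1 - d) * D - r * V" for d r
    unfolding D_eps_sq_def V_def D_def
    by (simp add: matrix_vector_mult_diff_rdistrib scaleR_matrix_vector_assoc[symmetric] inner_diff_right)
  have sym: "transpose (D_eps_sq D0sq V0sq d r) = D_eps_sq D0sq V0sq d r" for d r
  proof -
    have "transpose V0sq = V0sq" "transpose D0sq = D0sq" using psd by (simp_all add: sym_pd_def)
    then show ?thesis
      unfolding D_eps_sq_def by (simp add: transpose_def vec_eq_iff)
  qed
  have "0 \<le> x \<bullet> (D_eps_sq D0sq V0sq (-\<delta>) (-\<rho>) *v x)" for x
  proof -
    have "0 \<le> x \<bullet> (V0sq *v x)" "0 \<le> x \<bullet> (D0sq *v x)"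
      using psd(1,2)[THEN sym_pd_imp_psd] by (auto simp: sym_psd_def)
    then show ?thesis
      using pos unfolding D_eps_sq_def
      by (simp add: matrix_vector_mult_diff_rdistrib scaleR_matrix_vector_assoc[symmetric]
          inner_diff_right matrix_vector_mult_add_rdistrib inner_add_right)
  qed
  then have psd': "sym_psd (D_eps_sq D0sq V0sq (-\<delta>) (-\<rho>))" by (simp add: sym_psd_def sym)
  have norms: "(norm (sym_root (D_eps_sq D0sq V0sq \<delta> \<rho>) *v h))\<^sup>2 = (1 - \<delta>) * D - \<rho> * V"
    "(norm (sym_root (D_eps_sq D0sq V0sq (-\<delta>) (-\<rho>)) *v h))\<^sup>2 = (1 + \<delta>) * D + \<rho> * V"
    using norm_sym_root_sq[OF psd(3), of h] norm_sym_root_sq[OF psd', of h] by (simp_all add: eps)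
  define m where "m = (\<integral>y. L y \<theta> - L y \<theta>s \<partial>P)"
  have m: "- (1 + \<delta>) / 2 * D \<le> m" "m \<le> - (1 - \<delta>) / 2 * D"
  proof -
    have "\<bar>- 2 * m - D\<bar> \<le> \<delta> * D"
    proof (cases "h = 0")
      case True
      then show ?thesis by (simp add: m_def D_def h_def)
    next
      case False
      then have "0 < D" using psd by (simp add: D_def sym_pd_def)
      moreover have "\<bar>- 2 * m / D - 1\<bar> \<le> \<delta>"
        using \<delta> False unfolding m_def D[symmetric] by (simp add: h_def)
      moreover have "- 2 * m - D = (- 2 * m / D - 1) * D" using \<open>0 < D\<close> by (simp add: field_simps)
      ultimately show ?thesis by (simp add: abs_mult mult_right_mono)
    qed
    then show "- (1 + \<delta>) / 2 * D \<le> m" "m \<le> - (1 - \<delta>) / 2 * D"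
      by (simp_all add: abs_le_iff field_simps)
  qed
  have "m = mean_L P L \<theta> - mean_L P L \<theta>s"
    using int by (simp add: m_def mean_L_def)
  then have rem: "lin_remainder (stoch P L y) \<theta>s \<theta> = L y \<theta> - L y \<theta>s - m - h \<bullet> grad (L y) \<theta>s"
    by (simp add: lin_remainder_def stoch_def grad h_def)
  show "quad_L L (D_eps_sq D0sq V0sq (-\<delta>) (-\<rho>)) y \<theta> \<theta>s
      - (- lin_remainder (stoch P L y) \<theta>s \<theta> - \<rho> / 2 * (norm (sym_root V0sq *v (\<theta> - \<theta>s)))\<^sup>2) \<le> L y \<theta> - L y \<theta>s"
    unfolding quad_L_def rem h_def[symmetric] V norms using m by (simp add: field_simps)
  show "L y \<theta> - L y \<theta>s \<le> quad_L L (D_eps_sq D0sq V0sq \<delta> \<rho>) y \<theta> \<theta>s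
      + (lin_remainder (stoch P L y) \<theta>s \<theta> - \<rho> / 2 * (norm (sym_root V0sq *v (\<theta> - \<theta>s)))\<^sup>2)"
    unfolding quad_L_def rem h_def[symmetric] V norms using m by (simp add: field_simps)
qed

theorem theorem3p1:
  fixes P :: "'y measure"
    and L :: "'y \<Rightarrow> real^'p \<Rightarrow> real"
    and \<Theta> :: "(real^'p) set"
    and \<theta>s :: "real^'p"
    and V0sq D0sq :: "real^'p^'p"
    and g \<nu>0 r0 r \<omega>r \<delta>r \<rho> \<delta> :: real
  defines "\<zeta> \<equiv> stoch P L"
    and "\<Theta>0 \<equiv> local_set \<Theta> V0sq \<theta>s r"
  assumes "prob_space P"
    and "\<forall>\<theta>\<in>\<Theta>. integrable P (\<lambda>y. L y \<theta>)"
    and "is_arg_max (mean_L P L) (\<lambda>\<theta>. \<theta> \<in> \<Theta>) \<theta>s"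
    and "GDERIV (mean_L P L) \<theta>s :> 0"
    and "\<forall>y\<in>space P. \<forall>\<theta>\<in>\<Theta>. \<zeta> y differentiable (at \<theta>)"
    and "sym_pd V0sq"
    and "g > 0" and "\<nu>0 \<ge> 1" and "r0 > 0" and "r \<le> r0"
    and "\<omega>r \<in> {0..1/2}"
    and "gradient_moment_cond P \<zeta> \<Theta>0 \<theta>s V0sq g \<nu>0 \<omega>r"
    and "sym_pd D0sq"
    and "\<delta>r \<in> {0..1/2}"
    and "\<forall>\<theta>\<in>\<Theta>0. \<theta> \<noteq> \<theta>s \<longrightarrow>
           \<bar>(- 2 * (\<integral>y. L y \<theta> - L y \<theta>s \<partial>P)) / (norm (sym_root D0sq *v (\<theta> - \<theta>s)))\<^sup>2 - 1\<bar> \<le> \<delta>r"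
    and "\<rho> \<ge> 3 * \<nu>0 * \<omega>r" and "\<delta> \<ge> \<delta>r"
    and "sym_psd (D_eps_sq D0sq V0sq \<delta> \<rho>)"
  shows "(\<forall>y\<in>space P. \<forall>\<theta>\<in>\<Theta>0.
            ereal (quad_L L (D_eps_sq D0sq V0sq (-\<delta>) (-\<rho>)) y \<theta> \<theta>s) - err_lower \<zeta> \<Theta>0 \<theta>s V0sq \<rho> y
              \<le> ereal (L y \<theta> - L y \<theta>s)
          \<and> ereal (L y \<theta> - L y \<theta>s)
              \<le> ereal (quad_L L (D_eps_sq D0sq V0sq \<delta> \<rho>) y \<theta> \<theta>s) + err_upper \<zeta> \<Theta>0 \<theta>s V0sq \<rho> y)
       \<and> (g * \<nu>0 \<ge> 3 \<and> \<rho> > 0 \<and> convex \<Theta>0 \<longrightarrow>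
            err_upper \<zeta> \<Theta>0 \<theta>s V0sq \<rho> \<in> borel_measurable P
          \<and> err_lower \<zeta> \<Theta>0 \<theta>s V0sq \<rho> \<in> borel_measurable P
          \<and> (\<forall>x>0.
               measure P {y\<in>space P. ereal (inverse \<rho>) * err_upper \<zeta> \<Theta>0 \<theta>s V0sq \<rho> y
                   \<ge> ereal (z0 (g * \<nu>0) x (entropy_Q CARD('p)))} \<le> exp (- x)
             \<and> measure P {y\<in>space P. ereal (inverse \<rho>) * err_lower \<zeta> \<Theta>0 \<theta>s V0sq \<rho> y
                   \<ge> ereal (z0 (g * \<nu>0) x (entropy_Q CARD('p)))} \<le> exp (- x)))"
proof -
  interpret prob_space P by fact
  note int = \<open>\<forall>\<theta>\<in>\<Theta>. integrable P (\<lambda>y. L y \<theta>)\<close>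
  have sub: "\<Theta>0 \<subseteq> \<Theta>" by (auto simp: \<Theta>0_def local_set_def)
  have \<theta>s: "\<theta>s \<in> \<Theta>" using \<open>is_arg_max (mean_L P L) (\<lambda>\<theta>. \<theta> \<in> \<Theta>) \<theta>s\<close> by (simp add: is_arg_max_def)
  have \<zeta>diff: "\<zeta> y differentiable (at \<theta>)" if "y \<in> space P" "\<theta> \<in> \<Theta>" for y \<theta>
    using \<open>\<forall>y\<in>space P. \<forall>\<theta>\<in>\<Theta>. \<zeta> y differentiable (at \<theta>)\<close> that by blast
  have pos: "0 \<le> \<omega>r" "0 \<le> \<delta>" "0 \<le> \<rho>"
  proof -
    show "0 \<le> \<omega>r" "0 \<le> \<delta>" using \<open>\<omega>r \<in> {0..1/2}\<close> \<open>\<delta>r \<in> {0..1/2}\<close> \<open>\<delta> \<ge> \<delta>r\<close> by auto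
    then have "0 \<le> 3 * \<nu>0 * \<omega>r" using \<open>\<nu>0 \<ge> 1\<close> by simp
    then show "0 \<le> \<rho>" using \<open>\<rho> \<ge> 3 * \<nu>0 * \<omega>r\<close> by linarith
  qed
  have upper: "err_upper \<zeta> \<Theta>0 \<theta>s V0sq \<rho> y = (SUP \<theta>\<in>\<Theta>0. ereal (1 * lin_remainder (\<zeta> y) \<theta>s \<theta>
      - \<rho> / 2 * (norm (sym_root V0sq *v (\<theta> - \<theta>s)))\<^sup>2))" for y
    by (simp add: err_upper_def lin_remainder_def)
  have lower: "err_lower \<zeta> \<Theta>0 \<theta>s V0sq \<rho> y = (SUP \<theta>\<in>\<Theta>0. ereal (- 1 * lin_remainder (\<zeta> y) \<theta>s \<theta>
      - \<rho> / 2 * (norm (sym_root V0sq *v (\<theta> - \<theta>s)))\<^sup>2))" for y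
    unfolding err_lower_def lin_remainder_def by (intro SUP_cong refl) (simp add: algebra_simps)
  have bracket: "ereal (quad_L L (D_eps_sq D0sq V0sq (-\<delta>) (-\<rho>)) y \<theta> \<theta>s) - err_lower \<zeta> \<Theta>0 \<theta>s V0sq \<rho> y
        \<le> ereal (L y \<theta> - L y \<theta>s)
      \<and> ereal (L y \<theta> - L y \<theta>s)
        \<le> ereal (quad_L L (D_eps_sq D0sq V0sq \<delta> \<rho>) y \<theta> \<theta>s) + err_upper \<zeta> \<Theta>0 \<theta>s V0sq \<rho> y"
    if y: "y \<in> space P" and \<theta>: "\<theta> \<in> \<Theta>0" for y \<theta>
  proof -
    have "GDERIV (\<lambda>\<theta>. \<zeta> y \<theta> + mean_L P L \<theta>) \<theta>s :> grad (\<zeta> y) \<theta>s + 0"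
      by (intro GDERIV_add GDERIV_grad \<zeta>diff y \<theta>s \<open>GDERIV (mean_L P L) \<theta>s :> 0\<close>)
    then have grad: "grad (L y) \<theta>s = grad (stoch P L y) \<theta>s"
      by (intro grad_eqI) (simp add: \<zeta>_def stoch_def)
    have \<delta>: "\<bar>(- 2 * (\<integral>y. L y \<theta> - L y \<theta>s \<partial>P)) / (norm (sym_root D0sq *v (\<theta> - \<theta>s)))\<^sup>2 - 1\<bar> \<le> \<delta>"
      if "\<theta> \<noteq> \<theta>s"
      using assms(17) \<theta> that \<open>\<delta> \<ge> \<delta>r\<close> by fastforce
    note br = quad_form_bracketing[OF _ _ grad \<open>sym_pd V0sq\<close> \<open>sym_pd D0sq\<close>
        \<open>sym_psd (D_eps_sq D0sq V0sq \<delta> \<rho>)\<close> \<delta> pos(2,3), folded \<zeta>_def]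
    have int': "integrable P (\<lambda>y. L y \<theta>)" "integrable P (\<lambda>y. L y \<theta>s)"
      using int \<theta> \<theta>s sub by auto
    define u where "u = lin_remainder (\<zeta> y) \<theta>s \<theta> - \<rho> / 2 * (norm (sym_root V0sq *v (\<theta> - \<theta>s)))\<^sup>2"
    define l where "l = - lin_remainder (\<zeta> y) \<theta>s \<theta> - \<rho> / 2 * (norm (sym_root V0sq *v (\<theta> - \<theta>s)))\<^sup>2"
    have u: "ereal u \<le> err_upper \<zeta> \<Theta>0 \<theta>s V0sq \<rho> y"
      unfolding upper u_def by (rule SUP_upper2[OF \<theta>]) simp
    have l: "ereal l \<le> err_lower \<zeta> \<Theta>0 \<theta>s V0sq \<rho> y"
      unfolding lower l_def by (rule SUP_upper2[OF \<theta>]) simp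
    have "ereal (quad_L L (D_eps_sq D0sq V0sq (-\<delta>) (-\<rho>)) y \<theta> \<theta>s) - err_lower \<zeta> \<Theta>0 \<theta>s V0sq \<rho> y
        \<le> ereal (quad_L L (D_eps_sq D0sq V0sq (-\<delta>) (-\<rho>)) y \<theta> \<theta>s) - ereal l"
      using l by (intro ereal_minus_mono) auto
    also have "\<dots> \<le> ereal (L y \<theta> - L y \<theta>s)"
      using br(1)[OF int'] by (simp add: l_def)
    finally have "ereal (quad_L L (D_eps_sq D0sq V0sq (-\<delta>) (-\<rho>)) y \<theta> \<theta>s) - err_lower \<zeta> \<Theta>0 \<theta>s V0sq \<rho> y
        \<le> ereal (L y \<theta> - L y \<theta>s)" .
    moreover have "ereal (L y \<theta> - L y \<theta>s) \<le> ereal (quad_L L (D_eps_sq D0sq V0sq \<delta> \<rho>) y \<theta> \<theta>s) + ereal u"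
      using br(2)[OF int'] by (simp add: u_def)
    then have "ereal (L y \<theta> - L y \<theta>s)
        \<le> ereal (quad_L L (D_eps_sq D0sq V0sq \<delta> \<rho>) y \<theta> \<theta>s) + err_upper \<zeta> \<Theta>0 \<theta>s V0sq \<rho> y"
      using add_left_mono[OF u] by (rule order_trans)
    ultimately show ?thesis by blast
  qed
  have "err_upper \<zeta> \<Theta>0 \<theta>s V0sq \<rho> \<in> borel_measurable P
      \<and> err_lower \<zeta> \<Theta>0 \<theta>s V0sq \<rho> \<in> borel_measurable P
      \<and> (\<forall>x>0.
           measure P {y\<in>space P. ereal (inverse \<rho>) * err_upper \<zeta> \<Theta>0 \<theta>s V0sq \<rho> y
               \<ge> ereal (z0 (g * \<nu>0) x (entropy_Q CARD('p)))} \<le> exp (- x)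
         \<and> measure P {y\<in>space P. ereal (inverse \<rho>) * err_lower \<zeta> \<Theta>0 \<theta>s V0sq \<rho> y
               \<ge> ereal (z0 (g * \<nu>0) x (entropy_Q CARD('p)))} \<le> exp (- x))"
    if "g * \<nu>0 \<ge> 3 \<and> \<rho> > 0 \<and> convex \<Theta>0"
  proof -
    from that have g0: "3 \<le> g * \<nu>0" and \<rho>: "0 < \<rho>" and conv: "convex \<Theta>0" by auto
    have \<theta>s0: "\<Theta>0 \<noteq> {} \<longrightarrow> \<theta>s \<in> \<Theta>0"
    proof
      assume "\<Theta>0 \<noteq> {}"
      then obtain \<theta> where "norm (sym_root V0sq *v (\<theta> - \<theta>s)) \<le> r"
        by (auto simp: \<Theta>0_def local_set_def)
      then have "0 \<le> r" using norm_ge_zero order_trans by blast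
      then show "\<theta>s \<in> \<Theta>0" using \<theta>s by (simp add: \<Theta>0_def local_set_def)
    qed
    have meas: "\<forall>\<theta>\<in>\<Theta>0. (\<lambda>y. \<zeta> y \<theta>) \<in> borel_measurable P"
    proof
      fix \<theta> assume "\<theta> \<in> \<Theta>0"
      then have "(\<lambda>y. L y \<theta>) \<in> borel_measurable P" using int sub by auto
      then show "(\<lambda>y. \<zeta> y \<theta>) \<in> borel_measurable P" unfolding \<zeta>_def stoch_def by simp
    qed
    have diff: "\<forall>y\<in>space P. \<forall>\<theta>\<in>\<Theta>0. \<zeta> y differentiable (at \<theta>)"
      using \<zeta>diff sub by blast
    note sup = penalized_remainder_sup[OF \<open>prob_space P\<close> conv \<theta>s0 meas diff
        \<open>gradient_moment_cond P \<zeta> \<Theta>0 \<theta>s V0sq g \<nu>0 \<omega>r\<close> \<open>sym_pd V0sq\<close> \<open>g > 0\<close> \<open>\<nu>0 \<ge> 1\<close> pos(1) \<rho>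
        \<open>\<rho> \<ge> 3 * \<nu>0 * \<omega>r\<close> _ g0]
    have "\<bar>1 :: real\<bar> = 1" "\<bar>- 1 :: real\<bar> = 1" by simp_all
    note sup_upper = sup[OF this(1), folded upper] and sup_lower = sup[OF this(2), folded lower]
    show ?thesis using sup_upper sup_lower by auto
  qed
  with bracket show ?thesis by blast
qed

end
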